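(* Fix a real number $\varepsilon > 0$ and positive integers $k$, $t$ and $s$ satisfying $\max(t+1,s)\le k$. Then there is a positive integer $r_{\varepsilon}$ such that for every integer $r\ge r_{\varepsilon}$, we have $$M(n,r,k,t,s) \le (1+\varepsilon)\,r^{-s/(k-t)} \binom{n}{s}$$ for all sufficiently large $n$ (where the threshold on $n$ may depend on $r$).
   Context: $K_n^k$ denotes the complete $k$-uniform hypergraph on a vertex set $V_n$ of size $n$, where $n\ge k\ge 2$ (its edges are all $k$-subsets of $V_n$). Hypergraphs are identified with their edge sets. For a hypergraph or edge set $H$ and a positive integer $s$, the $s$-shadow is $E^{(s)}(H)=\{S : |S|=s,\ \exists e\in H: S\subseteq e\}$. For a hypergraph $H$, the $t$-tight components of $H$ are the classes of the partition of the edges of $H$ obtained by starting from singletons (one per edge) and iteratively merging two classes whenever one contains an edge $e$ and the other an edge $f$ with $|e\cap f|\ge t$, until no further merging is possible; $TC_t(H)$ is the family of these edge sets. $\mathrm{Col}_r(H)$ is the family of all (not necessarily proper) colorings of the edges of $H$ with colors $1,\dots,r$ (not all colors need be used). For $\mathbf{c}\in \mathrm{Col}_r(K_n^k)$ let $H_i=H_i(\mathbf{c})$ be the $k$-uniform hypergraph of all edges of color $i$, and define $$M(n,r,k,t,s;\mathbf{c})=\max_{i\in\{1,\dots,r\}}\ \max_{C\in TC_t(H_i)}|E^{(s)}(C)|$$ (color classes with no edges are ignored), and $M(n,r,k,t,s)=\min_{\mathbf{c}\in \mathrm{Col}_r(K_n^k)} M(n,r,k,t,s;\mathbf{c})$.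 *)

theory Defs
  imports Complex_Main "HOL-Library.FuncSet" "HOL-Library.Ramsey" "HOL-Library.Disjoint_Sets"
begin

text \<open>Hypergraphs are identified with their edge sets. The complete \<open>k\<close>-uniform hypergraph
  on a vertex set \<open>V\<close> is \<^term>\<open>nsets V k\<close>, and we take \<open>V\<^sub>n = {..<n}\<close>.\<close>

definition shadow :: "nat \<Rightarrow> 'a set set \<Rightarrow> 'a set set" where
  "shadow s H = {S. card S = s \<and> (\<exists>e\<in>H. S \<subseteq> e)}"

definition merge_step :: "nat \<Rightarrow> 'a set set set \<Rightarrow> 'a set set set \<Rightarrow> bool" where
  "merge_step t P Q \<longleftrightarrow>
     (\<exists>A\<in>P. \<exists>B\<in>P. A \<noteq> B \<and> (\<exists>e\<in>A. \<exists>f\<in>B. t \<le> card (e \<inter> f)) \<and> Q = insert (A \<union> B) (P - {A, B}))"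

text \<open>For finite \<open>H\<close> every merging process ends, and it always ends in the same partition, so
  the description below is proper; see \<open>tight_components_eq_quotient\<close>.\<close>

definition tight_components :: "nat \<Rightarrow> 'a set set \<Rightarrow> 'a set set set" where
  "tight_components t H =
     (THE P. (merge_step t)\<^sup>*\<^sup>* ((\<lambda>e. {e}) ` H) P \<and> (\<nexists>Q. merge_step t P Q))"

definition colorings :: "nat \<Rightarrow> 'a set set \<Rightarrow> ('a set \<Rightarrow> nat) set" where
  "colorings r H = (H \<rightarrow>\<^sub>E {1..r})"

definition color_class :: "'a set set \<Rightarrow> ('a set \<Rightarrow> nat) \<Rightarrow> nat \<Rightarrow> 'a set set" where
  "color_class H c i = {e \<in> H. c e = i}"

text \<open>The maxima below range over nonempty sets when \<open>r \<ge> 1\<close> and \<open>n \<ge> k\<close>;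
  for other parameters \<open>Max\<close> and \<open>Min\<close> may be unspecified.\<close>

definition M_coloring :: "nat \<Rightarrow> nat \<Rightarrow> nat \<Rightarrow> nat \<Rightarrow> nat \<Rightarrow> (nat set \<Rightarrow> nat) \<Rightarrow> nat" where
  "M_coloring n r k t s c =
     (MAX i\<in>{i\<in>{1..r}. color_class (nsets {..<n} k) c i \<noteq> {}}.
        MAX C\<in>tight_components t (color_class (nsets {..<n} k) c i). card (shadow s C))"

definition M :: "nat \<Rightarrow> nat \<Rightarrow> nat \<Rightarrow> nat \<Rightarrow> nat \<Rightarrow> nat" where
  "M n r k t s = (MIN c\<in>colorings r (nsets {..<n} k). M_coloring n r k t s c)"

definition tight_adj :: "nat \<Rightarrow> 'a set set \<Rightarrow> ('a set \<times> 'a set) set" where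
  "tight_adj t H = {(e, f). e \<in> H \<and> f \<in> H \<and> t \<le> card (e \<inter> f)}"

lemma merge_steps_partition:
  assumes "(merge_step t)\<^sup>*\<^sup>* ((\<lambda>e. {e}) ` H) P"
  shows "partition_on H P \<and> (\<forall>A\<in>P. \<forall>e\<in>A. \<forall>f\<in>A. (e, f) \<in> (tight_adj t H)\<^sup>*)"
  using assms
proof (induction rule: rtranclp_induct)
  case base
  then show ?case by (auto simp: partition_on_def disjoint_def)
next
  case (step P Q)
  then obtain A B e f where AB: "A \<in> P" "B \<in> P" "A \<noteq> B" "e \<in> A" "f \<in> B" "t \<le> card (e \<inter> f)"
    and Q: "Q = insert (A \<union> B) (P - {A, B})"
    by (auto simp: merge_step_def)
  have part: "partition_on H P"
    and con: "\<And>A e f. A \<in> P \<Longrightarrow> e \<in> A \<Longrightarrow> f \<in> A \<Longrightarrow> (e, f) \<in> (tight_adj t H)\<^sup>*"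
    using step.IH by auto
  have UP: "\<Union>P = H" and dis: "\<And>X Y. X \<in> P \<Longrightarrow> Y \<in> P \<Longrightarrow> X \<noteq> Y \<Longrightarrow> X \<inter> Y = {}" and ne: "{} \<notin> P"
    using part by (auto simp: partition_on_def disjoint_def)
  have "\<Union>Q = A \<union> B \<union> \<Union>(P - {A, B})" unfolding Q by simp
  also have "\<dots> = H" using AB(1,2) by (auto simp: UP[symmetric])
  finally have "\<Union>Q = H" .
  moreover have "disjoint Q"
  proof (rule disjointI)
    fix X Y assume XY: "X \<in> Q" "Y \<in> Q" "X \<noteq> Y"
    have *: "(A \<union> B) \<inter> Z = {}" if "Z \<in> P - {A, B}" for Z
      using dis[of A Z] dis[of B Z] AB(1,2) that by (auto simp: Int_Un_distrib2)
    consider "X = A \<union> B" "Y \<in> P - {A, B}" | "Y = A \<union> B" "X \<in> P - {A, B}" | "X \<in> P" "Y \<in> P"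
      using XY unfolding Q by (elim insertE) simp_all
    then show "X \<inter> Y = {}"
      by cases (use * dis XY(3) in \<open>simp_all add: Int_commute\<close>)
  qed
  moreover have "{} \<notin> Q" using ne AB Q by auto
  ultimately have "partition_on H Q" by (auto simp: partition_on_def)
  moreover have "(x, y) \<in> (tight_adj t H)\<^sup>*" if X: "X \<in> Q" and xy: "x \<in> X" "y \<in> X" for X x y
  proof -
    have "e \<in> H" "f \<in> H" using AB UP by auto
    then have ef: "(e, f) \<in> (tight_adj t H)\<^sup>*" and fe: "(f, e) \<in> (tight_adj t H)\<^sup>*"
      using AB(6) by (auto simp: tight_adj_def Int_commute intro!: r_into_rtrancl)
    consider "X \<in> P" | "X = A \<union> B" using X Q by auto
    then show ?thesis
    proof cases
      case 1
      then show ?thesis using con xy by blast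
    next
      case 2
      have a: "(u, v) \<in> (tight_adj t H)\<^sup>*" if "u \<in> A" "v \<in> B" for u v
        using con[OF AB(1) that(1) AB(4)] ef con[OF AB(2) AB(5) that(2)] by (meson rtrancl_trans)
      have b: "(v, u) \<in> (tight_adj t H)\<^sup>*" if "u \<in> A" "v \<in> B" for u v
        using con[OF AB(1) AB(4) that(1)] fe con[OF AB(2) that(2) AB(5)] by (meson rtrancl_trans)
      show ?thesis using 2 xy con AB(1,2) a b by blast
    qed
  qed
  ultimately show ?case by blast
qed

lemma merge_terminal_eq_quotient:
  assumes st: "(merge_step t)\<^sup>*\<^sup>* ((\<lambda>e. {e}) ` H) P" and fin: "\<nexists>Q. merge_step t P Q"
  shows "P = H // (tight_adj t H)\<^sup>*"
proof -
  let ?R = "tight_adj t H"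
  have UP: "\<Union>P = H" and ne: "{} \<notin> P"
    and con: "\<And>A e f. A \<in> P \<Longrightarrow> e \<in> A \<Longrightarrow> f \<in> A \<Longrightarrow> (e, f) \<in> ?R\<^sup>*"
    using merge_steps_partition[OF st] by (auto simp: partition_on_def)
  have closed: "f \<in> A" if "A \<in> P" "e \<in> A" "(e, f) \<in> ?R\<^sup>*" for A e f
    using that(3)
  proof (induction rule: rtrancl_induct)
    case base
    then show ?case by (rule that(2))
  next
    case (step y z)
    then obtain B where B: "B \<in> P" "z \<in> B" using UP by (auto simp: tight_adj_def)
    have "A = B"
    proof (rule ccontr)
      assume "A \<noteq> B"
      then have "merge_step t P (insert (A \<union> B) (P - {A, B}))"
        using step B that(1) unfolding merge_step_def tight_adj_def by blast
      then show False using fin by blast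
    qed
    then show ?case using B by simp
  qed
  have cls: "A = ?R\<^sup>* `` {e}" if "A \<in> P" "e \<in> A" for A e
    using closed[OF that] con[OF that] by blast
  show ?thesis
  proof (intro equalityI subsetI)
    fix A assume A: "A \<in> P"
    then obtain e where e: "e \<in> A" using ne by fastforce
    then have "e \<in> H" using A UP by auto
    then show "A \<in> H // ?R\<^sup>*" using cls[OF A e] by (auto simp: quotient_def)
  next
    fix A assume "A \<in> H // ?R\<^sup>*"
    then obtain e where e: "e \<in> H" "A = ?R\<^sup>* `` {e}" by (auto simp: quotient_def)
    then obtain B where "B \<in> P" "e \<in> B" using UP by auto
    then show "A \<in> P" using cls e by metis
  qed
qed

lemma merge_terminates:
  assumes "finite P"
  shows "\<exists>Q. (merge_step t)\<^sup>*\<^sup>* P Q \<and> (\<nexists>Q'. merge_step t Q Q')"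
  using assms
proof (induction "card P" arbitrary: P rule: less_induct)
  case less
  show ?case
  proof (cases "\<exists>Q. merge_step t P Q")
    case True
    then obtain Q where Q: "merge_step t P Q" by blast
    then obtain A B where AB: "A \<in> P" "B \<in> P" "A \<noteq> B" "Q = insert (A \<union> B) (P - {A, B})"
      by (auto simp: merge_step_def)
    have "card {A, B} \<le> card P" using AB less.prems by (intro card_mono) auto
    then have "card (P - {A, B}) + 2 = card P"
      using AB less.prems by (subst card_Diff_subset) auto
    moreover have "card Q \<le> Suc (card (P - {A, B}))"
      using AB(4) less.prems by (simp add: card_insert_if)
    ultimately have "card Q < card P" by linarith
    moreover have "finite Q" using AB less.prems by simp
    ultimately show ?thesis using less.hyps Q by (meson converse_rtranclp_into_rtranclp)
  qed blast
qed

lemma tight_components_eq_quotient: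
  assumes "finite H"
  shows "tight_components t H = H // (tight_adj t H)\<^sup>*"
proof -
  obtain P where P: "(merge_step t)\<^sup>*\<^sup>* ((\<lambda>e. {e}) ` H) P" "\<nexists>Q. merge_step t P Q"
    using merge_terminates[of "(\<lambda>e. {e}) ` H" t] assms by auto
  have "tight_components t H = P"
    unfolding tight_components_def
  proof (rule the_equality)
    fix Q assume "(merge_step t)\<^sup>*\<^sup>* ((\<lambda>e. {e}) ` H) Q \<and> (\<nexists>Q'. merge_step t Q Q')"
    then show "Q = P"
      using merge_terminal_eq_quotient[of t H Q] merge_terminal_eq_quotient[OF P] by simp
  qed (use P in simp)
  then show ?thesis using merge_terminal_eq_quotient[OF P] by simp
qed

end

theory Submission
  imports Defs "HOL-Real_Asymp.Real_Asymp"
begin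

text \<open>
  A coloring is good as soon as every edge \<open>e\<close> can be given a \<^emph>\<open>block\<close>, a set of vertices
  that contains \<open>e\<close>, in such a way that two edges of the same color that share \<open>t\<close> vertices
  have the same block: the block is then constant on each tight component, so a component lives
  inside one block. If all blocks have at most \<open>\<alpha> n\<close> vertices, the \<open>s\<close>-shadow of a component has
  at most \<open>(\<alpha> n choose s) \<le> \<alpha>^s (n choose s)\<close> elements. The goal is therefore
  \<open>\<alpha> = (1 + o(1)) r^(-1/(k - t))\<close>.

  The blocks come from a finite design whose size does not depend on \<open>n\<close>. Take \<open>v\<close> points and a
  large constant \<open>b\<close>. Ideally one wants \<open>b\<close>-sets of points that cover every \<open>k\<close>-set exactly
  once, colored so that every \<open>t\<close>-set lies in exactly one block of each color. Counting the
  \<open>k\<close>-sets above a \<open>t\<close>-set, such a system has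
  \<open>(v-t choose k-t) / (b-t choose k-t)\<close> colors, which is about \<open>(v/b)^(k-t)\<close> when \<open>b\<close> is
  large, and a block contains the fraction \<open>b/v\<close> of all points; this is the desired trade-off
  between \<open>r\<close> and \<open>\<alpha>\<close>. An exact system need not exist, but an approximate one does for large \<open>v\<close>:
  a system of colored blocks is a matching in the hypergraph whose vertices are the \<open>k\<close>-sets
  together with the pairs (\<open>t\<close>-set, color), a colored block being the set of all such vertices that
  it uses up. For the above number of colors this hypergraph is almost regular, with codegrees
  smaller by a factor \<open>O(1/v)\<close>, so for large \<open>v\<close> it has an almost perfect matching
  (\<open>near_perfect_matching\<close>). One moreover needs that above \<^emph>\<open>every\<close> \<open>t\<close>-set only a small proportion of the \<open>k\<close>-sets stays
  uncovered. The uncovered \<open>k\<close>-sets then serve as their own blocks and are colored greedily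
  with few additional colors (\<open>tight_block_coloring\<close>).

  The matching is built edge by edge, as in the random greedy algorithm. If all
  degrees among the available edges are nearly equal, a random next edge shrinks every degree, and
  every test set, on average by a factor that is known almost exactly.
  Instead of proving concentration for a random process, a sum of exponentials of the
  deviations serves as potential: its average over the next edge does not exceed its present
  value, hence some choice of the edge does not increase it, and as long as it is below 1 all
  deviations are small.

  Finally the \<open>n\<close> vertices have to be mapped to the points. Each point receives about the same
  number of vertices, so edges may contain several vertices with the same image, and such edges
  cannot be disregarded or given colors of their own: the edges of one color above a \<open>t\<close>-set lie in
  one component, so nearly all colors are needed above every \<open>t\<close>-set. They are repaired with \<open>k\<close> additional points which are the image of no vertex: a
  set of vertices whose image is too small is padded with the first few of these points
  (\<open>pad\<close>). Padding preserves cardinalities and inclusions, so edges that share \<open>t\<close> vertices have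
  padded images that share \<open>t\<close> points.
\<close>

section \<open>Exponential moments and incidence counts\<close>

lemma exp_le_quadratic:
  fixes x :: real
  assumes "\<bar>x\<bar> \<le> 1"
  shows "exp x \<le> 1 + x + x\<^sup>2"
proof (cases "0 \<le> x")
  case True
  then show ?thesis using exp_bound[of x] assms by simp
next
  case False
  have "(1 + x + x\<^sup>2) * (1 - x) = 1 - x ^ 3"
    by (simp add: algebra_simps power2_eq_square power3_eq_cube)
  moreover have "x ^ 3 \<le> 0" using False by simp
  ultimately have "1 \<le> (1 + x + x\<^sup>2) * (1 - x)" by linarith
  moreover have "0 \<le> 1 + x + x\<^sup>2"
    using False assms by (simp add: abs_if split: if_splits) 
  ultimately have "1 \<le> (1 + x + x\<^sup>2) * exp (- x)"
    using exp_ge_add_one_self[of "-x"] by (smt (verit) mult_left_mono)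
  then show ?thesis by (simp add: exp_minus field_simps)
qed

text \<open>The moment bound behind Freedman's inequality, for the uniform average over \<open>S\<close>: the second
  moment of \<open>Y\<close> is estimated by \<open>\<beta>\<close> times its first absolute moment. This suffices because in
  the greedy algorithm a quantity hardly ever changes, while its changes are uniformly small.\<close>
lemma sum_exp_le:
  fixes Y :: "'a \<Rightarrow> real"
  assumes "finite S" "0 \<le> \<alpha>" "0 \<le> \<beta>" "\<alpha> * \<beta> \<le> 1"
    and Y: "\<And>f. f \<in> S \<Longrightarrow> \<bar>Y f\<bar> \<le> \<beta>"
    and mean: "(\<Sum>f\<in>S. Y f) \<le> real (card S) * a"
    and absmean: "(\<Sum>f\<in>S. \<bar>Y f\<bar>) \<le> real (card S) * b"
  shows "(\<Sum>f\<in>S. exp (\<alpha> * Y f)) \<le> real (card S) * exp (\<alpha> * a + \<alpha>\<^sup>2 * \<beta> * b)"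
proof -
  have pt: "exp (\<alpha> * Y f) \<le> 1 + \<alpha> * Y f + \<alpha>\<^sup>2 * \<beta> * \<bar>Y f\<bar>" if f: "f \<in> S" for f
  proof -
    have "\<alpha> * \<bar>Y f\<bar> \<le> \<alpha> * \<beta>" using Y[OF f] assms(2) by (rule mult_left_mono)
    then have "\<bar>\<alpha> * Y f\<bar> \<le> 1" using assms by (simp add: abs_mult)
    then have "exp (\<alpha> * Y f) \<le> 1 + \<alpha> * Y f + (\<alpha> * Y f)\<^sup>2" by (rule exp_le_quadratic)
    moreover have "(\<alpha> * Y f)\<^sup>2 \<le> \<alpha>\<^sup>2 * \<beta> * \<bar>Y f\<bar>"
    proof -
      have "(Y f)\<^sup>2 = \<bar>Y f\<bar> * \<bar>Y f\<bar>" by (simp add: power2_eq_square)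
      also have "\<dots> \<le> \<beta> * \<bar>Y f\<bar>" using Y[OF f] by (intro mult_right_mono) auto
      finally have "\<alpha>\<^sup>2 * (Y f)\<^sup>2 \<le> \<alpha>\<^sup>2 * (\<beta> * \<bar>Y f\<bar>)" by (rule mult_left_mono) simp
      then show ?thesis by (simp add: power_mult_distrib mult.assoc)
    qed
    ultimately show ?thesis by linarith
  qed
  have "(\<Sum>f\<in>S. exp (\<alpha> * Y f)) \<le> (\<Sum>f\<in>S. 1 + \<alpha> * Y f + \<alpha>\<^sup>2 * \<beta> * \<bar>Y f\<bar>)"
    by (rule sum_mono) (rule pt)
  also have "\<dots> = real (card S) + \<alpha> * (\<Sum>f\<in>S. Y f) + \<alpha>\<^sup>2 * \<beta> * (\<Sum>f\<in>S. \<bar>Y f\<bar>)"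
    by (simp add: sum.distrib sum_distrib_left)
  also have "\<dots> \<le> real (card S) + \<alpha> * (real (card S) * a) + \<alpha>\<^sup>2 * \<beta> * (real (card S) * b)"
    using mean absmean assms(2,3) by (intro add_mono mult_left_mono) auto
  also have "\<dots> = real (card S) * (1 + (\<alpha> * a + \<alpha>\<^sup>2 * \<beta> * b))" by (simp add: algebra_simps)
  also have "\<dots> \<le> real (card S) * exp (\<alpha> * a + \<alpha>\<^sup>2 * \<beta> * b)"
    by (intro mult_left_mono exp_ge_add_one_self) auto
  finally show ?thesis .
qed

lemma card_hit_le:
  assumes "finite S" "finite A"
  shows "card {f\<in>S. f \<inter> A \<noteq> {}} \<le> (\<Sum>y\<in>A. card {f\<in>S. y \<in> f})"
proof -
  have "{f\<in>S. f \<inter> A \<noteq> {}} = (\<Union>y\<in>A. {f\<in>S. y \<in> f})" by auto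
  then show ?thesis using card_UN_le[OF assms(2)] by metis
qed

text \<open>A Bonferroni inequality. A set \<open>f\<close> meeting \<open>A\<close> in \<open>a \<ge> 1\<close> elements contributes \<open>a\<close> to the left
  and \<open>1 + a (a - 1) \<ge> a\<close> to the right. The error term counts ordered pairs, which only costs a
  constant factor and keeps the sum over codegrees simple.\<close>
lemma card_hit_ge:
  assumes "finite S" "finite A"
  shows "(\<Sum>y\<in>A. card {f\<in>S. y \<in> f})
    \<le> card {f\<in>S. f \<inter> A \<noteq> {}} + (\<Sum>y\<in>A. \<Sum>z\<in>A-{y}. card {f\<in>S. y \<in> f \<and> z \<in> f})"
proof -
  have c: "card {f\<in>S. P f} = (\<Sum>f\<in>S. of_bool (P f))" for P
    using assms(1) by (simp add: Int_def)
  have pt: "(\<Sum>y\<in>A. of_bool (y \<in> f)) \<le> (of_bool (f \<inter> A \<noteq> {}) :: nat)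
      + (\<Sum>y\<in>A. \<Sum>z\<in>A-{y}. of_bool (y \<in> f \<and> z \<in> f))" for f
  proof (cases "f \<inter> A = {}")
    case True
    then have "(\<Sum>y\<in>A. of_bool (y \<in> f)) = (0::nat)" by (intro sum.neutral) auto
    then show ?thesis by simp
  next
    case False
    then obtain z0 where z0: "z0 \<in> f" "z0 \<in> A" by auto
    have "(\<Sum>y\<in>A. of_bool (y \<in> f)) = (1::nat) + (\<Sum>y\<in>A-{z0}. of_bool (y \<in> f))"
      using z0 assms(2) by (subst sum.remove[of _ z0]) auto
    also have "(\<Sum>y\<in>A-{z0}. of_bool (y \<in> f)) = (\<Sum>z\<in>A-{z0}. of_bool (z0 \<in> f \<and> z \<in> f))"
      using z0 by simp
    also have "\<dots> \<le> (\<Sum>y\<in>A. \<Sum>z\<in>A-{y}. (of_bool (y \<in> f \<and> z \<in> f) :: nat))"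
      using z0(2) assms(2) by (intro member_le_sum[of z0 A "\<lambda>y. \<Sum>z\<in>A-{y}. of_bool (y \<in> f \<and> z \<in> f)"]) auto
    finally show ?thesis using False by simp
  qed
  have swap: "(\<Sum>f\<in>S. \<Sum>y\<in>A. \<Sum>z\<in>A-{y}. (of_bool (y \<in> f \<and> z \<in> f) :: nat))
      = (\<Sum>y\<in>A. \<Sum>z\<in>A-{y}. \<Sum>f\<in>S. of_bool (y \<in> f \<and> z \<in> f))"
    by (subst sum.swap) (intro sum.cong refl, rule sum.swap)
  have "(\<Sum>y\<in>A. card {f\<in>S. y \<in> f}) = (\<Sum>f\<in>S. \<Sum>y\<in>A. of_bool (y \<in> f))"
    unfolding c by (rule sum.swap)
  also have "\<dots> \<le> (\<Sum>f\<in>S. of_bool (f \<inter> A \<noteq> {}) + (\<Sum>y\<in>A. \<Sum>z\<in>A-{y}. of_bool (y \<in> f \<and> z \<in> f)))"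
    by (rule sum_mono) (rule pt)
  also have "\<dots> = card {f\<in>S. f \<inter> A \<noteq> {}} + (\<Sum>y\<in>A. \<Sum>z\<in>A-{y}. card {f\<in>S. y \<in> f \<and> z \<in> f})"
    unfolding c sum.distrib by (simp only: swap)
  finally show ?thesis .
qed

lemma sum_card_incidence:
  assumes "finite S" "finite U" "\<And>e. e \<in> S \<Longrightarrow> e \<subseteq> U \<and> card e = K"
  shows "(\<Sum>y\<in>U. card {e\<in>S. y \<in> e}) = K * card S"
proof -
  have "(\<Sum>y\<in>U. card {e\<in>S. y \<in> e}) = (\<Sum>e\<in>S. card {y\<in>U. y \<in> e})"
    by (rule sum_multicount_gen[OF assms(2,1)]) (use assms in auto)
  also have "\<dots> = (\<Sum>e\<in>S. K)"
  proof (rule sum.cong[OF refl])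
    fix e assume "e \<in> S"
    then have "{y\<in>U. y \<in> e} = e" "card e = K" using assms(3) by auto
    then show "card {y\<in>U. y \<in> e} = K" by simp
  qed
  finally show ?thesis by simp
qed

section \<open>The greedy matching algorithm with a potential function\<close>

text \<open>The quantities followed by the algorithm are, for each index \<open>\<iota>\<close>, the number of members of
  the family \<open>F \<iota>\<close> that are disjoint from the set \<open>C\<close> of vertices covered so far. All members of
  \<open>F \<iota>\<close> have \<open>j \<iota>\<close> elements, and \<open>size \<iota>\<close> is the intended initial cardinality of \<open>F \<iota>\<close>. Degrees
  are of this kind: for a vertex \<open>x\<close> one follows the sets \<open>e - {x}\<close> for the edges \<open>e\<close> at \<open>x\<close>.
  Removing \<open>x\<close> itself lets the quantity vary smoothly even after \<open>x\<close> has been covered. A test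
  set \<open>S\<close> is followed through the singletons of its elements.\<close>
locale tracked_hypergraph =
  fixes V :: "'v set" and H :: "'v set set" and K :: nat and D \<eta> :: real
    and I :: "'i set" and F :: "'i \<Rightarrow> 'v set set" and j :: "'i \<Rightarrow> nat" and size :: "'i \<Rightarrow> real"
  assumes fin_V: "finite V"
    and edge: "e \<in> H \<Longrightarrow> e \<subseteq> V \<and> card e = K"
    and K_pos: "1 \<le> K" and D_pos: "0 < D" and eta_nonneg: "0 \<le> \<eta>"
    and codeg: "x \<noteq> y \<Longrightarrow> real (card {e\<in>H. x \<in> e \<and> y \<in> e}) \<le> \<eta> * D"
    and fin_I: "finite I"
    and member: "\<iota> \<in> I \<Longrightarrow> A \<in> F \<iota> \<Longrightarrow> A \<subseteq> V \<and> card A = j \<iota>"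
    and j_le: "\<iota> \<in> I \<Longrightarrow> j \<iota> \<le> K"
    and size_pos: "\<iota> \<in> I \<Longrightarrow> 0 < size \<iota>"
    and spread: "\<iota> \<in> I \<Longrightarrow> y \<in> V \<Longrightarrow> real (card {A\<in>F \<iota>. y \<in> A}) \<le> \<eta> * size \<iota>"
    and degree_tracked:
      "x \<in> V \<Longrightarrow> \<exists>\<iota>\<in>I. size \<iota> = D \<and> j \<iota> = K - 1 \<and> F \<iota> = (\<lambda>e. e - {x}) ` {e\<in>H. x \<in> e}"
begin

definition avail :: "'v set \<Rightarrow> 'v set set" where
  "avail C = {e\<in>H. e \<inter> C = {}}"

definition alive :: "'v set \<Rightarrow> 'i \<Rightarrow> 'v set set" where
  "alive C \<iota> = {A\<in>F \<iota>. A \<inter> C = {}}"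

lemma fin_H: "finite H"
  using edge fin_V by (auto intro: finite_subset[of _ "Pow V"])

lemma fin_F: "\<iota> \<in> I \<Longrightarrow> finite (F \<iota>)"
  using member fin_V by (auto intro: finite_subset[of _ "Pow V"])

lemma fin_avail: "finite (avail C)" using fin_H by (simp add: avail_def)

lemma fin_alive: "\<iota> \<in> I \<Longrightarrow> finite (alive C \<iota>)" using fin_F by (simp add: alive_def)

lemma avail_edge: "e \<in> avail C \<Longrightarrow> e \<subseteq> V - C \<and> card e = K"
  using edge[of e] by (auto simp: avail_def)

text \<open>When all degrees of available edges at uncovered vertices are \<open>(1 \<plusminus> \<delta>) m\<close>, a uniformly random
  available edge covers a given uncovered vertex with probability about \<open>K / u\<close>, where \<open>u\<close> is
  the number of uncovered vertices: \<open>u\<close> times the degree is \<open>K\<close> times the number of edges, so the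
  common degree \<open>m\<close> cancels. It therefore destroys a given \<open>j\<close>-set with probability about
  \<open>\<theta> = j K / u\<close>; the codegree condition makes hits in two points negligible.\<close>
lemma loss_sum:
  assumes \<delta>: "0 < \<delta>" "\<delta> \<le> 1/5" and m: "0 < m" and small: "(real K)\<^sup>2 * (\<eta> * D) \<le> \<delta> * m"
    and deg: "\<And>y. y \<in> V - C \<Longrightarrow> (1 - \<delta>) * m \<le> real (card {e\<in>avail C. y \<in> e})
        \<and> real (card {e\<in>avail C. y \<in> e}) \<le> (1 + \<delta>) * m"
    and ne: "V - C \<noteq> {}" and \<iota>: "\<iota> \<in> I"
  defines "h \<equiv> real (card (avail C))" and "u \<equiv> real (card (V - C))"
    and "W \<equiv> real (card (alive C \<iota>))"
  defines "\<theta> \<equiv> real (j \<iota>) * real K / u"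
  shows "0 < h"
    and "(1 - 5 * \<delta>) * (\<theta> * h * W) \<le> (\<Sum>f\<in>avail C. real (card {A\<in>alive C \<iota>. f \<inter> A \<noteq> {}}))"
    and "(\<Sum>f\<in>avail C. real (card {A\<in>alive C \<iota>. f \<inter> A \<noteq> {}})) \<le> (1 + 5 * \<delta>) * (\<theta> * h * W)"
proof -
  have fU: "finite (V - C)" using fin_V by simp
  have u: "u > 0" using ne fU by (auto simp: u_def card_gt_0_iff)
  have K0: "real K > 0" using K_pos by simp
  have dc: "(\<Sum>y\<in>V-C. real (card {e\<in>avail C. y \<in> e})) = real K * h"
    using sum_card_incidence[OF fin_avail fU, of C K] avail_edge[of _ C]
    by (simp add: h_def flip: of_nat_sum)
  have "(\<Sum>y\<in>V-C. (1 - \<delta>) * m) \<le> real K * h" unfolding dc[symmetric]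
    by (rule sum_mono) (use deg in blast)
  then have lo: "u * ((1 - \<delta>) * m) \<le> real K * h" by (simp add: u_def)
  have "real K * h \<le> (\<Sum>y\<in>V-C. (1 + \<delta>) * m)" unfolding dc[symmetric]
    by (rule sum_mono) (use deg in blast)
  then have hi: "real K * h \<le> u * ((1 + \<delta>) * m)" by (simp add: u_def)
  have "0 < u * ((1 - \<delta>) * m)" using u m \<delta> by simp
  then have "0 < real K * h" using lo by linarith
  then show h: "0 < h" using K0 by (simp add: zero_less_mult_iff)
  have th: "\<theta> * h = real (j \<iota>) * (real K * h / u)" by (simp add: \<theta>_def)
  have lo': "(1 - \<delta>) * m \<le> real K * h / u" and hi': "real K * h / u \<le> (1 + \<delta>) * m"
    using lo hi u by (simp_all add: field_simps)
  have one: "(1 - 5 * \<delta>) * (\<theta> * h) \<le> real (card {f\<in>avail C. f \<inter> A \<noteq> {}})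
      \<and> real (card {f\<in>avail C. f \<inter> A \<noteq> {}}) \<le> (1 + 5 * \<delta>) * (\<theta> * h)"
    if A: "A \<in> alive C \<iota>" for A
  proof (cases "j \<iota> = 0")
    case True
    then have "A = {}" using A member[OF \<iota>, of A] fin_V
      by (auto simp: alive_def dest: finite_subset)
    then show ?thesis using True by (simp add: \<theta>_def)
  next
    case False
    have AU: "A \<subseteq> V - C" and cA: "card A = j \<iota>" using A member[OF \<iota>, of A] by (auto simp: alive_def)
    have fA: "finite A" using AU fU finite_subset by blast
    define x where "x = real (card {f\<in>avail C. f \<inter> A \<noteq> {}})"
    have J: "1 \<le> real (j \<iota>)" "real (j \<iota>) \<le> real K" using False j_le[OF \<iota>] by auto
    have "x \<le> (\<Sum>y\<in>A. real (card {f\<in>avail C. y \<in> f}))"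
      using card_hit_le[OF fin_avail fA, of C] unfolding x_def by (simp flip: of_nat_sum)
    also have "\<dots> \<le> (\<Sum>y\<in>A. (1 + \<delta>) * m)" by (rule sum_mono) (use deg AU in blast)
    also have "\<dots> = real (j \<iota>) * ((1 + \<delta>) * m)" using cA by simp
    also have "\<dots> \<le> real (j \<iota>) * ((1 + 5 * \<delta>) * ((1 - \<delta>) * m))"
    proof -
      have "1 + \<delta> \<le> (1 + 5 * \<delta>) * (1 - \<delta>)"
        using \<delta> mult_left_mono[of \<delta> "1/5" \<delta>] by (simp add: algebra_simps)
      then have "(1 + \<delta>) * m \<le> (1 + 5 * \<delta>) * (1 - \<delta>) * m" using m by (intro mult_right_mono) auto
      then show ?thesis by (simp add: mult.assoc mult_left_mono)
    qed
    also have "\<dots> \<le> real (j \<iota>) * ((1 + 5 * \<delta>) * (real K * h / u))"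
      using lo' \<delta> by (intro mult_left_mono) auto
    finally have up: "x \<le> (1 + 5 * \<delta>) * (\<theta> * h)" unfolding th by (simp add: ac_simps)
    have cd: "real (card {f\<in>avail C. y \<in> f \<and> z \<in> f}) \<le> \<eta> * D" if "z \<noteq> y" for y z
    proof -
      have "card {f\<in>avail C. y \<in> f \<and> z \<in> f} \<le> card {f\<in>H. y \<in> f \<and> z \<in> f}"
        using fin_H by (intro card_mono) (auto simp: avail_def)
      then show ?thesis using codeg[OF that[symmetric]] by linarith
    qed
    have "real (j \<iota>) * ((1 - \<delta>) * m) = (\<Sum>y\<in>A. (1 - \<delta>) * m)" using cA by simp
    also have "\<dots> \<le> (\<Sum>y\<in>A. real (card {f\<in>avail C. y \<in> f}))"
      by (rule sum_mono) (use deg AU in blast)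
    also have "\<dots> \<le> x + (\<Sum>y\<in>A. \<Sum>z\<in>A-{y}. real (card {f\<in>avail C. y \<in> f \<and> z \<in> f}))"
      using card_hit_ge[OF fin_avail fA, of C] unfolding x_def
      by (simp flip: of_nat_sum of_nat_add)
    also have "(\<Sum>y\<in>A. \<Sum>z\<in>A-{y}. real (card {f\<in>avail C. y \<in> f \<and> z \<in> f}))
        \<le> (\<Sum>y\<in>A. \<Sum>z\<in>A-{y}. \<eta> * D)"
      by (intro sum_mono cd) auto
    also have "\<dots> \<le> (\<Sum>y\<in>A. real K * (\<eta> * D))"
    proof (rule sum_mono)
      fix y assume "y \<in> A"
      have "real (card (A - {y})) \<le> real K"
        using cA j_le[OF \<iota>] card_Diff1_le[of A y] by linarith
      then show "(\<Sum>z\<in>A-{y}. \<eta> * D) \<le> real K * (\<eta> * D)"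
        using eta_nonneg D_pos by (simp add: mult_right_mono)
    qed
    also have "\<dots> = real (j \<iota>) * (real K * (\<eta> * D))" using cA by simp
    also have "\<dots> \<le> real K * (real K * (\<eta> * D))"
      using J eta_nonneg D_pos by (intro mult_right_mono) auto
    also have "\<dots> \<le> \<delta> * m" using small by (simp add: power2_eq_square mult.assoc)
    also have "\<dots> \<le> real (j \<iota>) * (\<delta> * m)" using J \<delta> m by simp
    finally have "real (j \<iota>) * ((1 - 2 * \<delta>) * m) \<le> x" by (simp add: algebra_simps)
    moreover have "(1 - 5 * \<delta>) * (real K * h / u) \<le> (1 - 2 * \<delta>) * m"
    proof -
      have "(1 - 5 * \<delta>) * (real K * h / u) \<le> (1 - 5 * \<delta>) * ((1 + \<delta>) * m)"
        using hi' \<delta> by (intro mult_left_mono) auto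
      also have "\<dots> = ((1 - 5 * \<delta>) * (1 + \<delta>)) * m" by simp
      also have "\<dots> \<le> (1 - 2 * \<delta>) * m"
        using m \<delta> by (intro mult_right_mono) (auto simp: algebra_simps)
      finally show ?thesis .
    qed
    ultimately have "real (j \<iota>) * ((1 - 5 * \<delta>) * (real K * h / u)) \<le> x"
      using J by (smt (verit) mult_left_mono)
    then have "(1 - 5 * \<delta>) * (\<theta> * h) \<le> x" unfolding th by (simp add: ac_simps)
    with up show ?thesis unfolding x_def by simp
  qed
  have sw: "(\<Sum>f\<in>avail C. real (card {A\<in>alive C \<iota>. f \<inter> A \<noteq> {}}))
      = (\<Sum>A\<in>alive C \<iota>. real (card {f\<in>avail C. f \<inter> A \<noteq> {}}))"
  proof -
    have "(\<Sum>f\<in>avail C. card {A\<in>alive C \<iota>. f \<inter> A \<noteq> {}})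
      = (\<Sum>A\<in>alive C \<iota>. card {f\<in>avail C. f \<inter> A \<noteq> {}})"
      by (rule sum_multicount_gen) (use fin_avail fin_alive[OF \<iota>] in auto)
    then show ?thesis by (simp flip: of_nat_sum)
  qed
  have "(1 - 5 * \<delta>) * (\<theta> * h * W) = (\<Sum>A\<in>alive C \<iota>. (1 - 5 * \<delta>) * (\<theta> * h))"
    by (simp add: W_def)
  also have "\<dots> \<le> (\<Sum>A\<in>alive C \<iota>. real (card {f\<in>avail C. f \<inter> A \<noteq> {}}))"
    by (rule sum_mono) (use one in blast)
  finally show "(1 - 5 * \<delta>) * (\<theta> * h * W) \<le> (\<Sum>f\<in>avail C. real (card {A\<in>alive C \<iota>. f \<inter> A \<noteq> {}}))"
    unfolding sw .
  have "(\<Sum>A\<in>alive C \<iota>. real (card {f\<in>avail C. f \<inter> A \<noteq> {}})) \<le> (\<Sum>A\<in>alive C \<iota>. (1 + 5 * \<delta>) * (\<theta> * h))"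
    by (rule sum_mono) (use one in blast)
  also have "\<dots> = (1 + 5 * \<delta>) * (\<theta> * h * W)"
    by (simp add: W_def)
  finally show "(\<Sum>f\<in>avail C. real (card {A\<in>alive C \<iota>. f \<inter> A \<noteq> {}})) \<le> (1 + 5 * \<delta>) * (\<theta> * h * W)"
    unfolding sw .
qed

end

text \<open>A two-sided exponential penalty for \<open>X\<close> leaving the interval \<open>[1 - \<delta>, 1 + \<delta>]\<close>.\<close>
definition pot :: "real \<Rightarrow> real \<Rightarrow> real \<Rightarrow> real" where
  "pot \<alpha> \<delta> X = exp (\<alpha> * (X - 1 - \<delta>)) + exp (\<alpha> * (1 - \<delta> - X))"

lemma pot_nonneg: "0 \<le> pot \<alpha> \<delta> X" by (simp add: pot_def)

lemma pot_less_one: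
  assumes "pot \<alpha> \<delta> X < 1" "0 < \<alpha>"
  shows "\<bar>X - 1\<bar> \<le> \<delta>"
proof -
  have "exp (\<alpha> * (X - 1 - \<delta>)) < 1" "exp (\<alpha> * (1 - \<delta> - X)) < 1"
    using assms(1) exp_gt_zero[of "\<alpha> * (X - 1 - \<delta>)"] exp_gt_zero[of "\<alpha> * (1 - \<delta> - X)"]
    unfolding pot_def by linarith+
  then have "\<alpha> * (X - 1 - \<delta>) < 0" "\<alpha> * (1 - \<delta> - X) < 0" by simp_all
  then have "X - 1 - \<delta> < 0" "1 - \<delta> - X < 0" using assms(2) by (simp_all add: mult_less_0_iff)
  then show ?thesis by linarith
qed

context tracked_hypergraph
begin

text \<open>One step of the algorithm, seen from one tracked family. The count \<open>W\<close>, expected to drop by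
  the factor \<open>1 - \<theta>\<close>, is compared with a reference value that drops by exactly this factor. The
  relative drift of the quotient is then at most a constant times \<open>\<delta> \<theta>\<close>, because the drop is
  only known up to the relative error \<open>5 \<delta>\<close> of \<open>loss_sum\<close>. Widening the tolerance from \<open>\<delta>\<close> to
  \<open>\<delta> + 30 \<delta> \<phi>\<close> absorbs this drift, together with the second-order term of the exponential
  moment. Here \<open>\<beta>\<close> bounds the change of the quotient in one step.\<close>
lemma pot_sum:
  assumes \<delta>: "0 < \<delta>" "\<delta> \<le> 1/5" and m: "0 < m"
    and small: "(real K)\<^sup>2 * (\<eta> * D) \<le> \<delta> * m"
    and deg: "\<And>y. y \<in> V - C \<Longrightarrow> (1 - \<delta>) * m \<le> real (card {e\<in>avail C. y \<in> e})
        \<and> real (card {e\<in>avail C. y \<in> e}) \<le> (1 + \<delta>) * m"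
    and ne: "V - C \<noteq> {}" and \<iota>: "\<iota> \<in> I"
  defines "h \<equiv> real (card (avail C))" and "u \<equiv> real (card (V - C))"
    and "W \<equiv> real (card (alive C \<iota>))"
  defines "\<theta> \<equiv> real (j \<iota>) * real K / u"
  assumes n: "0 < n" and X: "\<bar>W / (size \<iota> * n) - 1\<bar> \<le> \<delta>" and \<theta>\<phi>: "\<theta> \<le> \<phi>" "\<phi> \<le> 1/2"
    and \<alpha>: "0 \<le> \<alpha>" and \<beta>: "4 * \<phi> \<le> \<beta>" "2 * real K * \<eta> / n \<le> \<beta>" "\<alpha> * \<beta> \<le> \<delta>"
  shows "(\<Sum>f\<in>avail C. pot \<alpha> (\<delta> + 30 * \<delta> * \<phi>) (real (card (alive (C \<union> f) \<iota>)) / (size \<iota> * (n * (1 - \<theta>)))))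
    \<le> h * pot \<alpha> \<delta> (W / (size \<iota> * n))"
proof -
  define w where "w = (\<lambda>f. real (card {A\<in>alive C \<iota>. f \<inter> A \<noteq> {}}))"
  define S where "S = size \<iota>"
  define X where "X = W / (S * n)"
  define Z where "Z = S * (n * (1 - \<theta>))"
  define Y where "Y = (\<lambda>f. (\<theta> * W - w f) / Z)"
  have S0: "S > 0" using size_pos[OF \<iota>] by (simp add: S_def)
  note ls = loss_sum[OF \<delta> m small deg ne \<iota>, folded h_def u_def W_def, folded \<theta>_def w_def, simplified]
  have fU: "finite (V - C)" using fin_V by simp
  have u0: "u > 0" using ne fU by (auto simp: u_def card_gt_0_iff)
  have \<theta>0: "0 \<le> \<theta>" "\<theta> \<le> 1/2" using \<theta>\<phi> u0 by (linarith | simp add: \<theta>_def)+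
  have Z0: "Z > 0" using S0 n \<theta>0 by (simp add: Z_def)
  have Xd: "\<bar>X - 1\<bar> \<le> \<delta>" using X by (simp add: X_def S_def)
  have X1: "0 \<le> X" "X \<le> 6/5"
    using S0 n by (simp add: X_def W_def) (use Xd \<delta> in linarith)
  have WZ: "\<theta> * W / Z \<le> 12/5 * \<theta>"
  proof -
    have "\<theta> * W / Z = \<theta> * X / (1 - \<theta>)" using S0 n \<theta>0 by (simp add: X_def Z_def field_simps)
    also have "\<dots> \<le> \<theta> * (6/5) / (1/2)"
      using \<theta>0 X1 by (intro frac_le mult_left_mono) auto
    finally show ?thesis by simp
  qed
  have w0: "0 \<le> w f" for f by (simp add: w_def)
  have W0: "0 \<le> W" by (simp add: W_def)
  have w_le: "w f \<le> real K * (\<eta> * S)" if f: "f \<in> avail C" for f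
  proof -
    have fV: "f \<subseteq> V" "card f = K" using avail_edge[OF f] by auto
    have ff: "finite f" using fV fin_V finite_subset by blast
    have "card {A\<in>alive C \<iota>. A \<inter> f \<noteq> {}} \<le> (\<Sum>y\<in>f. card {A\<in>alive C \<iota>. y \<in> A})"
      by (rule card_hit_le[OF fin_alive[OF \<iota>] ff])
    then have "w f \<le> (\<Sum>y\<in>f. real (card {A\<in>alive C \<iota>. y \<in> A}))"
      by (simp add: w_def Int_commute flip: of_nat_sum)
    also have "\<dots> \<le> (\<Sum>y\<in>f. \<eta> * S)"
    proof (rule sum_mono)
      fix y assume y: "y \<in> f"
      have "card {A\<in>alive C \<iota>. y \<in> A} \<le> card {A\<in>F \<iota>. y \<in> A}"
        using fin_F[OF \<iota>] by (intro card_mono) (auto simp: alive_def)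
      then show "real (card {A\<in>alive C \<iota>. y \<in> A}) \<le> \<eta> * S"
        using spread[OF \<iota>, of y] y fV unfolding S_def by force
    qed
    finally show ?thesis using fV by simp
  qed
  have wZ: "w f / Z \<le> \<beta>" if f: "f \<in> avail C" for f
  proof -
    have "w f / Z \<le> (real K * (\<eta> * S)) / (S * (n * (1/2)))"
      unfolding Z_def using w_le[OF f] w0[of f] S0 n \<theta>0 by (intro frac_le mult_left_mono) auto
    also have "\<dots> = 2 * real K * \<eta> / n" using S0 n by (simp add: field_simps)
    finally show ?thesis using \<beta> by linarith
  qed
  have \<beta>0: "\<beta> \<ge> 0" using \<beta>(1) \<theta>0 \<theta>\<phi> by linarith
  have Yb: "\<bar>Y f\<bar> \<le> \<beta>" if f: "f \<in> avail C" for f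
  proof -
    have "Y f = \<theta> * W / Z - w f / Z" by (simp add: Y_def diff_divide_distrib)
    moreover have "0 \<le> \<theta> * W / Z" "0 \<le> w f / Z" using Z0 W0 \<theta>0 w0[of f] by auto
    moreover have "\<theta> * W / Z \<le> \<beta>" using WZ \<beta>(1) \<theta>\<phi> \<theta>0 by linarith
    ultimately show ?thesis using wZ[OF f] by linarith
  qed
  have sY: "(\<Sum>f\<in>avail C. Y f) = (\<theta> * h * W - (\<Sum>f\<in>avail C. w f)) / Z"
    by (simp add: Y_def sum_subtractf h_def diff_divide_distrib flip: sum_divide_distrib)
  have absY: "\<bar>\<Sum>f\<in>avail C. Y f\<bar> \<le> h * (20 * \<delta> * \<theta>)"
  proof -
    have "\<bar>\<theta> * h * W - (\<Sum>f\<in>avail C. w f)\<bar> \<le> 5 * \<delta> * (\<theta> * h * W)"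
      using ls(2,3) by (simp add: algebra_simps abs_le_iff)
    then have "\<bar>\<Sum>f\<in>avail C. Y f\<bar> \<le> 5 * \<delta> * (\<theta> * h * W) / Z"
      unfolding sY using Z0 by (simp add: abs_divide divide_right_mono)
    also have "\<dots> = 5 * \<delta> * h * (\<theta> * W / Z)" by simp
    also have "\<dots> \<le> 5 * \<delta> * h * (12/5 * \<theta>)" using WZ \<delta> ls(1) by (intro mult_left_mono) auto
    also have "\<dots> \<le> h * (20 * \<delta> * \<theta>)" using \<delta> ls(1) \<theta>0 by (simp add: mult_right_mono)
    finally show ?thesis .
  qed
  have abssum: "(\<Sum>f\<in>avail C. \<bar>Y f\<bar>) \<le> h * (10 * \<theta>)"
  proof -
    have "(\<Sum>f\<in>avail C. \<bar>Y f\<bar>) \<le> (\<Sum>f\<in>avail C. (\<theta> * W + w f) / Z)"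
    proof (rule sum_mono)
      fix f
      have "0 \<le> \<theta> * W" using \<theta>0 W0 by simp
      then show "\<bar>Y f\<bar> \<le> (\<theta> * W + w f) / Z"
        using Z0 w0[of f] by (simp add: Y_def abs_divide divide_right_mono)
    qed
    also have "\<dots> = (\<theta> * h * W + (\<Sum>f\<in>avail C. w f)) / Z"
      by (simp add: sum.distrib h_def add_divide_distrib flip: sum_divide_distrib)
    also have "\<dots> \<le> (3 * (\<theta> * h * W)) / Z"
    proof (intro divide_right_mono)
      have "(1 + 5 * \<delta>) * (\<theta> * h * W) \<le> 2 * (\<theta> * h * W)"
        using \<delta> \<theta>0 W0 ls(1) by (intro mult_right_mono) auto
      then show "\<theta> * h * W + (\<Sum>f\<in>avail C. w f) \<le> 3 * (\<theta> * h * W)" using ls(3) by linarith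
    qed (use Z0 in simp)
    also have "\<dots> = 3 * h * (\<theta> * W / Z)" by simp
    also have "\<dots> \<le> 3 * h * (12/5 * \<theta>)" using WZ ls(1) by (intro mult_left_mono) auto
    also have "\<dots> \<le> h * (10 * \<theta>)" using ls(1) \<theta>0 by (simp add: mult_right_mono)
    finally show ?thesis .
  qed
  have expo: "exp (\<alpha> * (20 * \<delta> * \<theta>) + \<alpha>\<^sup>2 * \<beta> * (10 * \<theta>)) \<le> exp (\<alpha> * (30 * \<delta> * \<phi>))"
  proof -
    have "\<alpha>\<^sup>2 * \<beta> * (10 * \<theta>) = \<alpha> * (\<alpha> * \<beta>) * (10 * \<theta>)" by (simp add: power2_eq_square)
    also have "\<dots> \<le> \<alpha> * \<delta> * (10 * \<theta>)"
      using \<beta>(3) \<alpha> \<theta>0 by (intro mult_right_mono mult_left_mono) auto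
    finally have "\<alpha> * (20 * \<delta> * \<theta>) + \<alpha>\<^sup>2 * \<beta> * (10 * \<theta>) \<le> \<alpha> * (30 * \<delta> * \<theta>)" by (simp add: algebra_simps)
    also have "\<dots> \<le> \<alpha> * (30 * \<delta> * \<phi>)" using \<alpha> \<theta>\<phi> \<delta> by (intro mult_left_mono) auto
    finally show ?thesis by simp
  qed
  have E1: "(\<Sum>f\<in>avail C. exp (\<alpha> * Y f)) \<le> h * exp (\<alpha> * (30 * \<delta> * \<phi>))"
  proof -
    have "(\<Sum>f\<in>avail C. exp (\<alpha> * Y f)) \<le> h * exp (\<alpha> * (20 * \<delta> * \<theta>) + \<alpha>\<^sup>2 * \<beta> * (10 * \<theta>))"
      unfolding h_def
      by (rule sum_exp_le[OF fin_avail \<alpha> \<beta>0]) (use Yb \<beta> \<delta> absY abssum in \<open>auto simp: h_def\<close>)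
    also have "\<dots> \<le> h * exp (\<alpha> * (30 * \<delta> * \<phi>))" using expo ls(1) by (intro mult_left_mono) auto
    finally show ?thesis .
  qed
  have E2: "(\<Sum>f\<in>avail C. exp (\<alpha> * (- Y f))) \<le> h * exp (\<alpha> * (30 * \<delta> * \<phi>))"
  proof -
    have "(\<Sum>f\<in>avail C. exp (\<alpha> * (- Y f))) \<le> h * exp (\<alpha> * (20 * \<delta> * \<theta>) + \<alpha>\<^sup>2 * \<beta> * (10 * \<theta>))"
      unfolding h_def
      by (rule sum_exp_le[OF fin_avail \<alpha> \<beta>0])
        (use Yb \<beta> \<delta> absY abssum in \<open>auto simp: h_def sum_negf\<close>)
    also have "\<dots> \<le> h * exp (\<alpha> * (30 * \<delta> * \<phi>))" using expo ls(1) by (intro mult_left_mono) auto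
    finally show ?thesis .
  qed
  have new: "real (card (alive (C \<union> f) \<iota>)) / Z = X + Y f" for f
  proof -
    have eq: "alive (C \<union> f) \<iota> = alive C \<iota> - {A\<in>alive C \<iota>. f \<inter> A \<noteq> {}}" by (auto simp: alive_def)
    have "real (card (alive (C \<union> f) \<iota>)) = W - w f"
      unfolding eq w_def W_def using fin_alive[OF \<iota>, of C]
      by (subst card_Diff_subset) (auto intro!: of_nat_diff card_mono)
    then show ?thesis using S0 n \<theta>0 by (simp add: X_def Y_def Z_def field_simps)
  qed
  define q where "q = \<alpha> * (30 * \<delta> * \<phi>)"
  define a where "a = exp (\<alpha> * (X - 1 - \<delta>))"
  define b where "b = exp (\<alpha> * (1 - \<delta> - X))"
  have "(\<Sum>f\<in>avail C. pot \<alpha> (\<delta> + 30 * \<delta> * \<phi>) (X + Y f))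
      = (\<Sum>f\<in>avail C. a * exp (- q) * exp (\<alpha> * Y f) + b * exp (- q) * exp (\<alpha> * (- Y f)))"
    by (rule sum.cong[OF refl]) (simp add: pot_def a_def b_def q_def algebra_simps flip: exp_add)
  also have "\<dots> = a * exp (- q) * (\<Sum>f\<in>avail C. exp (\<alpha> * Y f))
      + b * exp (- q) * (\<Sum>f\<in>avail C. exp (\<alpha> * (- Y f)))"
    by (simp add: sum.distrib sum_distrib_left)
  also have "\<dots> \<le> a * exp (- q) * (h * exp q) + b * exp (- q) * (h * exp q)"
    using E1 E2 by (intro add_mono mult_left_mono) (auto simp: q_def a_def b_def)
  also have "\<dots> = h * (a + b) * (exp (- q) * exp q)" by (simp add: algebra_simps)
  also have "exp (- q) * exp q = 1" by (simp flip: exp_add)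
  finally have "(\<Sum>f\<in>avail C. pot \<alpha> (\<delta> + 30 * \<delta> * \<phi>) (X + Y f)) \<le> h * pot \<alpha> \<delta> X"
    by (simp add: pot_def a_def b_def)
  then show ?thesis unfolding new[symmetric] by (simp add: X_def Z_def S_def)
qed

text \<open>The value \<open>n a\<close> is the expected proportion of surviving members in a family of \<open>a\<close>-sets.\<close>
definition ratio :: "(nat \<Rightarrow> real) \<Rightarrow> 'v set \<Rightarrow> 'i \<Rightarrow> real" where
  "ratio n C \<iota> = real (card (alive C \<iota>)) / (size \<iota> * n (j \<iota>))"

text \<open>Summing \<open>pot_sum\<close> over all families shows that the total potential does not grow on average
  over the available edges, so some edge does not increase it. The degree condition of \<open>pot_sum\<close>
  is itself one of the tracked statements.\<close>
lemma greedy_step: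
  assumes ne: "V - C \<noteq> {}" and \<delta>: "0 < \<delta>" "\<delta> \<le> 1/5"
    and n: "\<And>i. i \<le> K \<Longrightarrow> 0 < n i" and small: "(real K)\<^sup>2 * \<eta> \<le> \<delta> * n (K - 1)"
    and conc: "\<And>\<iota>. \<iota> \<in> I \<Longrightarrow> \<bar>ratio n C \<iota> - 1\<bar> \<le> \<delta>"
    and \<phi>: "(real K)\<^sup>2 / real (card (V - C)) \<le> \<phi>" "\<phi> \<le> 1/2"
    and \<alpha>: "0 \<le> \<alpha>"
    and \<beta>: "4 * \<phi> \<le> \<beta>" "\<And>i. i \<le> K \<Longrightarrow> 2 * real K * \<eta> / n i \<le> \<beta>" "\<alpha> * \<beta> \<le> \<delta>"
  defines "n' \<equiv> \<lambda>i. n i * (1 - real i * real K / real (card (V - C)))"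
  shows "\<exists>f\<in>avail C. (\<Sum>\<iota>\<in>I. pot \<alpha> (\<delta> + 30 * \<delta> * \<phi>) (ratio n' (C \<union> f) \<iota>)) \<le> (\<Sum>\<iota>\<in>I. pot \<alpha> \<delta> (ratio n C \<iota>))"
proof -
  define m where "m = D * n (K - 1)"
  have m0: "m > 0" using n[of "K-1"] D_pos by (simp add: m_def)
  have small': "(real K)\<^sup>2 * (\<eta> * D) \<le> \<delta> * m"
    using mult_right_mono[OF small, of D] D_pos by (simp add: m_def ac_simps)
  have deg: "(1 - \<delta>) * m \<le> real (card {e\<in>avail C. y \<in> e})
        \<and> real (card {e\<in>avail C. y \<in> e}) \<le> (1 + \<delta>) * m" if y: "y \<in> V - C" for y
  proof -
    obtain \<iota> where \<iota>: "\<iota> \<in> I" "size \<iota> = D" "j \<iota> = K - 1" "F \<iota> = (\<lambda>e. e - {y}) ` {e\<in>H. y \<in> e}"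
      using degree_tracked[of y] y by auto
    have "alive C \<iota> = (\<lambda>e. e - {y}) ` {e\<in>avail C. y \<in> e}"
      using y unfolding alive_def \<iota>(4) avail_def by auto
    moreover have "inj_on (\<lambda>e. e - {y}) {e\<in>avail C. y \<in> e}" by (auto simp: inj_on_def)
    ultimately have "card (alive C \<iota>) = card {e\<in>avail C. y \<in> e}" by (simp add: card_image)
    moreover have "\<bar>real (card (alive C \<iota>)) / m - 1\<bar> \<le> \<delta>"
      using conc[OF \<iota>(1)] by (simp add: ratio_def \<iota> m_def)
    ultimately show ?thesis using m0 by (simp add: abs_le_iff field_simps)
  qed
  define u where "u = real (card (V - C))"
  have u0: "u > 0" using ne fin_V by (auto simp: u_def card_gt_0_iff)
  have one: "(\<Sum>f\<in>avail C. pot \<alpha> (\<delta> + 30 * \<delta> * \<phi>) (ratio n' (C \<union> f) \<iota>))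
      \<le> real (card (avail C)) * pot \<alpha> \<delta> (ratio n C \<iota>)" if \<iota>: "\<iota> \<in> I" for \<iota>
  proof -
    have "real (j \<iota>) * real K / u \<le> real K * real K / u"
      using j_le[OF \<iota>] u0 by (intro divide_right_mono mult_right_mono) auto
    then have le: "real (j \<iota>) * real K / u \<le> \<phi>" using \<phi>(1) by (simp add: u_def power2_eq_square)
    from pot_sum[OF \<delta> m0 small' deg ne \<iota>, of "n (j \<iota>)" \<phi> \<alpha> \<beta>, folded u_def]
    show ?thesis
      using n[OF j_le[OF \<iota>]] conc[OF \<iota>] le \<phi>(2) \<alpha> \<beta>(1,3) \<beta>(2)[OF j_le[OF \<iota>]]
      by (simp add: ratio_def n'_def u_def)
  qed
  have h0: "0 < card (avail C)"
  proof -
    obtain y where "y \<in> V - C" using ne by auto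
    then have "0 < (1 - \<delta>) * m" "(1 - \<delta>) * m \<le> real (card {e\<in>avail C. y \<in> e})" using deg m0 \<delta> by auto
    then have "{e\<in>avail C. y \<in> e} \<noteq> {}" by force
    then show ?thesis using fin_avail by (auto simp: card_gt_0_iff)
  qed
  show ?thesis
  proof (rule ccontr)
    define P where "P = (\<lambda>f. \<Sum>\<iota>\<in>I. pot \<alpha> (\<delta> + 30 * \<delta> * \<phi>) (ratio n' (C \<union> f) \<iota>))"
    define Q where "Q = (\<Sum>\<iota>\<in>I. pot \<alpha> \<delta> (ratio n C \<iota>))"
    assume "\<not> ?thesis"
    then have gt: "Q < P f" if "f \<in> avail C" for f using that by (auto simp: P_def Q_def not_le)
    have "real (card (avail C)) * Q = (\<Sum>f\<in>avail C. Q)" by simp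
    also have "\<dots> < (\<Sum>f\<in>avail C. P f)"
      using h0 gt by (intro sum_strict_mono) (auto simp: card_gt_0_iff)
    also have "\<dots> = (\<Sum>\<iota>\<in>I. \<Sum>f\<in>avail C. pot \<alpha> (\<delta> + 30 * \<delta> * \<phi>) (ratio n' (C \<union> f) \<iota>))"
      unfolding P_def by (rule sum.swap)
    also have "\<dots> \<le> (\<Sum>\<iota>\<in>I. real (card (avail C)) * pot \<alpha> \<delta> (ratio n C \<iota>))"
      by (rule sum_mono) (rule one)
    also have "\<dots> = real (card (avail C)) * Q" by (simp add: Q_def sum_distrib_left)
    finally show False by simp
  qed
qed

end

context tracked_hypergraph
begin

text \<open>The algorithm runs while at least the proportion \<open>\<epsilon>\<close> of the vertices is uncovered. The
  tolerance grows geometrically; if \<open>\<phi>\<close> is of order \<open>1 / |V|\<close>, the whole run of at most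
  \<open>|V| / K\<close> steps multiplies it by a constant only.\<close>
lemma greedy_run:
  fixes \<epsilon> \<phi> \<delta> c \<alpha> \<beta> :: real and m :: nat
  defines "u \<equiv> \<lambda>i::nat. real (card V) - real i * real K"
  defines "n \<equiv> \<lambda>i a. \<Prod>l<i. 1 - real a * real K / u l"
  assumes \<epsilon>: "0 < \<epsilon>" and V0: "0 < card V"
    and \<phi>: "(real K)\<^sup>2 / (\<epsilon> * real (card V)) \<le> \<phi>" "\<phi> \<le> 1/2"
    and u: "\<And>l. l < m \<Longrightarrow> \<epsilon> * real (card V) \<le> u l"
    and \<delta>: "0 < \<delta>" "\<delta> * (1 + 30 * \<phi>) ^ m \<le> 1/5"
    and c: "0 < c" "\<And>i a. i \<le> m \<Longrightarrow> a \<le> K \<Longrightarrow> c \<le> n i a"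
    and small: "(real K)\<^sup>2 * \<eta> \<le> \<delta> * c"
    and \<alpha>: "0 < \<alpha>" and \<beta>: "4 * \<phi> \<le> \<beta>" "2 * real K * \<eta> / c \<le> \<beta>" "\<alpha> * \<beta> \<le> \<delta>"
    and init: "(\<Sum>\<iota>\<in>I. pot \<alpha> \<delta> (real (card (F \<iota>)) / size \<iota>)) < 1"
    and i: "i \<le> m"
  shows "\<exists>M\<subseteq>H. (\<forall>e\<in>M. \<forall>f\<in>M. e \<noteq> f \<longrightarrow> e \<inter> f = {}) \<and> card (\<Union>M) = i * K
    \<and> (\<Sum>\<iota>\<in>I. pot \<alpha> (\<delta> * (1 + 30 * \<phi>) ^ i) (ratio (n i) (\<Union>M) \<iota>)) < 1"
  using i
proof (induction i)
  case 0
  have "ratio (n 0) {} \<iota> = real (card (F \<iota>)) / size \<iota>" for \<iota>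
    by (simp add: ratio_def n_def alive_def)
  then show ?case using init by (intro exI[of _ "{}"]) simp
next
  case (Suc i)
  then obtain M where M: "M \<subseteq> H" "\<forall>e\<in>M. \<forall>f\<in>M. e \<noteq> f \<longrightarrow> e \<inter> f = {}" "card (\<Union>M) = i * K"
    and P: "(\<Sum>\<iota>\<in>I. pot \<alpha> (\<delta> * (1 + 30 * \<phi>) ^ i) (ratio (n i) (\<Union>M) \<iota>)) < 1"
    by auto
  define C where "C = \<Union>M"
  define d where "d = \<delta> * (1 + 30 * \<phi>) ^ i"
  have im: "i < m" "i \<le> m" using Suc.prems by auto
  have CV: "C \<subseteq> V" using M(1) edge by (auto simp: C_def)
  have \<phi>0: "0 \<le> \<phi>" using \<phi>(1) \<epsilon> by (smt (verit) divide_nonneg_nonneg mult_nonneg_nonneg of_nat_0_le_iff zero_le_power2)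
  have pow: "1 \<le> (1 + 30 * \<phi>) ^ i" using \<phi>0 by (intro one_le_power) simp
  have "(1 + 30 * \<phi>) ^ i \<le> (1 + 30 * \<phi>) ^ m" using \<phi>0 im by (intro power_increasing) auto
  then have "d \<le> \<delta> * (1 + 30 * \<phi>) ^ m" using \<delta>(1) by (simp add: d_def)
  then have d2: "d \<le> 1/5" using \<delta>(2) by linarith
  have d1: "\<delta> \<le> d" using \<delta>(1) pow by (simp add: d_def)
  note d = d1 d2 less_le_trans[OF \<delta>(1) d1]
  have fC: "finite C" using CV fin_V finite_subset by blast
  have "i * K \<le> card V" using M(3) CV fin_V card_mono unfolding C_def by metis
  then have cu: "real (card (V - C)) = u i"
    using CV fC M(3) by (simp add: card_Diff_subset u_def C_def of_nat_diff)
  have eV: "0 < \<epsilon> * real (card V)" using \<epsilon> V0 by simp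
  have u0: "0 < u i" using u[OF im(1)] eV by linarith
  then have ne: "V - C \<noteq> {}" using cu by (metis card.empty of_nat_0 less_irrefl)
  have conc: "\<bar>ratio (n i) C \<iota> - 1\<bar> \<le> d" if "\<iota> \<in> I" for \<iota>
  proof (rule pot_less_one[OF _ \<alpha>])
    have "pot \<alpha> d (ratio (n i) C \<iota>) \<le> (\<Sum>\<iota>\<in>I. pot \<alpha> d (ratio (n i) C \<iota>))"
      using that fin_I pot_nonneg by (intro member_le_sum) auto
    then show "pot \<alpha> d (ratio (n i) C \<iota>) < 1" using P by (simp add: d_def C_def)
  qed
  have "(real K)\<^sup>2 * \<eta> \<le> d * n i (K - 1)"
    using small mult_mono[of \<delta> d c "n i (K - 1)"] c(1) c(2)[OF im(2), of "K - 1"] d \<delta>(1) by auto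
  moreover have "(real K)\<^sup>2 / real (card (V - C)) \<le> \<phi>"
  proof -
    have "(real K)\<^sup>2 / u i \<le> (real K)\<^sup>2 / (\<epsilon> * real (card V))"
      using u[OF im(1)] eV by (intro frac_le) auto
    then show ?thesis using \<phi>(1) cu by simp
  qed
  moreover have "2 * real K * \<eta> / n i a \<le> \<beta>" if "a \<le> K" for a
  proof -
    have "2 * real K * \<eta> / n i a \<le> 2 * real K * \<eta> / c"
      using c(1) c(2)[OF im(2) that] eta_nonneg by (intro divide_left_mono) auto
    then show ?thesis using \<beta>(2) by linarith
  qed
  moreover have "0 < n i a" if "a \<le> K" for a using c(1) c(2)[OF im(2) that] by linarith
  ultimately obtain f where f: "f \<in> avail C"
    and le: "(\<Sum>\<iota>\<in>I. pot \<alpha> (d + 30 * d * \<phi>) (ratio (\<lambda>a. n i a * (1 - real a * real K / real (card (V - C)))) (C \<union> f) \<iota>))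
        \<le> (\<Sum>\<iota>\<in>I. pot \<alpha> d (ratio (n i) C \<iota>))"
    using greedy_step[OF ne d(3,2) _ _ conc _ \<phi>(2) less_imp_le[OF \<alpha>] \<beta>(1) _ order_trans[OF \<beta>(3) d(1)]]
    by blast
  have n': "(\<lambda>a. n i a * (1 - real a * real K / real (card (V - C)))) = n (Suc i)"
    by (simp add: n_def cu)
  have d': "d + 30 * d * \<phi> = \<delta> * (1 + 30 * \<phi>) ^ Suc i" by (simp add: d_def algebra_simps)
  have fH: "f \<in> H" "f \<inter> C = {}" using f by (auto simp: avail_def)
  have Un: "\<Union>(insert f M) = C \<union> f" by (auto simp: C_def)
  have ff: "finite f" using edge[OF fH(1)] fin_V finite_subset by blast
  have "card (C \<union> f) = i * K + K"
    using card_Un_disjoint[OF fC ff] fH edge M(3) by (auto simp: C_def)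
  moreover have "\<forall>e\<in>insert f M. \<forall>g\<in>insert f M. e \<noteq> g \<longrightarrow> e \<inter> g = {}"
    using M(2) fH(2) by (auto simp: C_def)
  moreover have "(\<Sum>\<iota>\<in>I. pot \<alpha> (\<delta> * (1 + 30 * \<phi>) ^ Suc i) (ratio (n (Suc i)) (C \<union> f) \<iota>)) < 1"
    using le P unfolding n' d' by (simp add: C_def d_def)
  ultimately show ?case using M(1) fH(1) Un by (intro exI[of _ "insert f M"]) (simp add: add.commute)
qed

end

lemma exp_minus_double_le:
  fixes x :: real
  assumes "0 \<le> x" "x \<le> 1/2"
  shows "exp (- 2 * x) \<le> 1 - x"
proof -
  have "- x - 2 * x\<^sup>2 \<le> ln (1 - x)" using ln_one_minus_pos_lower_bound[OF assms] .
  moreover have "2 * x\<^sup>2 \<le> x" using assms mult_left_mono[of x "1/2" x] by (simp add: power2_eq_square)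
  ultimately have "- 2 * x \<le> ln (1 - x)" by linarith
  then have "exp (- 2 * x) \<le> exp (ln (1 - x))" by simp
  then show ?thesis using assms by simp
qed

section \<open>Near-perfect matchings that are fair to test sets\<close>

text \<open>The final number of uncovered vertices is a small proportion of \<open>V\<close>, and the tracking of the
  test sets shows that each of them is covered in the same proportion. The potential
  starts below 1 since there are \<open>|V| + |\<S>|\<close> tracked families and each of them contributes at most
  \<open>2 exp (- \<alpha> \<delta> / 2)\<close>; this needs \<open>\<alpha>\<close> of the order of the logarithm \<open>L\<close> of their number. A
  single step must change the exponents by a bounded amount only, and the changes are of order
  \<open>\<alpha> \<eta>\<close>: this is why \<open>\<eta> L\<close> has to be small.\<close>
lemma near_perfect_matching:
  fixes K :: nat and \<epsilon> :: real
  assumes K: "1 \<le> K" and \<epsilon>: "0 < \<epsilon>" "\<epsilon> \<le> 1"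
  obtains c :: real where "0 < c"
    and "\<And>(V :: 'v set) H D \<eta> \<S>. \<lbrakk>finite V; \<forall>e\<in>H. e \<subseteq> V \<and> card e = K; 0 < D;
      \<forall>x\<in>V. \<bar>real (card {e\<in>H. x \<in> e}) - D\<bar> \<le> c * D;
      \<forall>x y. x \<noteq> y \<longrightarrow> real (card {e\<in>H. x \<in> e \<and> y \<in> e}) \<le> \<eta> * D;
      finite \<S>; \<forall>S\<in>\<S>. S \<subseteq> V \<and> 1 \<le> \<eta> * real (card S); 1 \<le> \<eta> * real (card V);
      \<eta> * ln (2 * real (card V + card \<S>) + 1) \<le> c\<rbrakk>
    \<Longrightarrow> \<exists>M\<subseteq>H. (\<forall>e\<in>M. \<forall>f\<in>M. e \<noteq> f \<longrightarrow> e \<inter> f = {}) \<and>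
      (\<forall>S\<in>\<S>. real (card (S - \<Union>M)) \<le> \<epsilon> * real (card S))"
proof -
  define e where "e = \<epsilon> / 4"
  have e: "0 < e" "e \<le> 1/4" using \<epsilon> by (auto simp: e_def)
  define \<delta> where "\<delta> = exp (- (30 * real K / e)) / 5"
  \<comment> \<open>The tolerance \<open>\<delta>\<close> is at most \<open>1/5\<close> even after growing by \<open>exp (30 K / e)\<close>, and \<open>c0\<close> bounds the
    expected surviving proportions from below; the terms of \<open>c\<close> are exactly what
    \<open>greedy_run\<close> and the initial potential need.\<close>
  define c0 where "c0 = exp (- (2 * real K / e))"
  define B where "B = 4 * (real K)\<^sup>2 / e + 2 * real K / c0"
  define c where "c = Min {\<delta> / 2, \<delta>\<^sup>2 / (2 * B), e / (2 * (real K)\<^sup>2), \<delta> * c0 / (real K)\<^sup>2}"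
  have K0: "real K > 0" using K by simp
  have \<delta>0: "0 < \<delta>" "\<delta> \<le> 1/5" using e K0 by (auto simp: \<delta>_def)
  have c00: "0 < c0" by (simp add: c0_def)
  have B0: "0 < B" using K0 e c00 by (auto simp: B_def intro!: add_pos_pos)
  have c: "0 < c" using \<delta>0 B0 e K0 c00 by (simp add: c_def)
  have cle: "c \<le> \<delta> / 2" "c \<le> \<delta>\<^sup>2 / (2 * B)" "c \<le> e / (2 * (real K)\<^sup>2)" "c \<le> \<delta> * c0 / (real K)\<^sup>2"
    unfolding c_def by (rule Min_le; simp)+
  show ?thesis
  proof (rule that[OF c])
    fix V :: "'v set" and H and D \<eta> :: real and \<S>
    assume fV: "finite V" and edge: "\<forall>e\<in>H. e \<subseteq> V \<and> card e = K" and D: "0 < D"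
      and deg: "\<forall>x\<in>V. \<bar>real (card {e\<in>H. x \<in> e}) - D\<bar> \<le> c * D"
      and codeg: "\<forall>x y. x \<noteq> y \<longrightarrow> real (card {e\<in>H. x \<in> e \<and> y \<in> e}) \<le> \<eta> * D"
      and fS: "finite \<S>" and S: "\<forall>S\<in>\<S>. S \<subseteq> V \<and> 1 \<le> \<eta> * real (card S)"
      and V1: "1 \<le> \<eta> * real (card V)"
      and \<eta>c: "\<eta> * ln (2 * real (card V + card \<S>) + 1) \<le> c"
    define N where "N = real (card V)"
    have N0: "0 < N"
    proof -
      have "card V \<noteq> 0" using V1 by (intro notI) simp
      then show ?thesis by (simp add: N_def)
    qed
    have \<eta>0: "0 < \<eta>" 
    proof (rule ccontr)
      assume "\<not> 0 < \<eta>"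
      then have "\<eta> * N \<le> 0" using N0 by (intro mult_nonpos_nonneg) auto
      then show False using V1 by (simp add: N_def)
    qed
    define L where "L = ln (2 * real (card V + card \<S>) + 1)"
    have L1: "1 \<le> L"
    proof -
      have "1 \<le> card V" using N0 by (simp add: N_def)
      then have "3 \<le> 2 * real (card V + card \<S>) + 1" by simp
      moreover have "exp 1 \<le> (3::real)" using exp_le by simp
      ultimately have "exp 1 \<le> 2 * real (card V + card \<S>) + 1" by linarith
      then show ?thesis unfolding L_def by (subst ln_ge_iff) auto
    qed
    have \<eta>L: "\<eta> * L \<le> c" using \<eta>c by (simp add: L_def)
    have "\<eta> * 1 \<le> \<eta> * L" using L1 \<eta>0 by (intro mult_left_mono) auto
    then have \<eta>le: "\<eta> \<le> c" using \<eta>L by simp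
    define I where "I = V <+> \<S>"
    define F where "F = case_sum (\<lambda>x. (\<lambda>e. e - {x}) ` {e\<in>H. x \<in> e}) (\<lambda>S. (\<lambda>y. {y}) ` S)"
    define j where "j = case_sum (\<lambda>x::'v. K - 1) (\<lambda>S::'v set. 1)"
    define size where "size = case_sum (\<lambda>x::'v. D) (\<lambda>S::'v set. real (card S))"
    have fH: "finite H" using edge fV by (auto intro: finite_subset[of _ "Pow V"])
    have inj: "inj_on (\<lambda>e. e - {x}) {e\<in>H. x \<in> e}" for x by (auto simp: inj_on_def)
    interpret tracked_hypergraph V H K D \<eta> I F j size
    proof
      show "finite V" "1 \<le> K" "0 < D" by fact+
      show "0 \<le> \<eta>" using \<eta>0 by simp
      show "finite I" using fV fS by (simp add: I_def)
      show "e \<subseteq> V \<and> card e = K" if "e \<in> H" for e using edge that by blast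
      show "real (card {e\<in>H. x \<in> e \<and> y \<in> e}) \<le> \<eta> * D" if "x \<noteq> y" for x y using codeg that by blast
      show "A \<subseteq> V \<and> card A = j \<iota>" if \<iota>: "\<iota> \<in> I" and A: "A \<in> F \<iota>" for \<iota> A
      proof (cases \<iota>)
        case (Inl x)
        then obtain e where "e \<in> H" "x \<in> e" "A = e - {x}" using A by (auto simp: F_def)
        then show ?thesis using edge fV finite_subset[of e V] by (auto simp: j_def Inl)
      next
        case (Inr S')
        then show ?thesis using \<iota> A S by (auto simp: I_def F_def j_def)
      qed
      show "j \<iota> \<le> K" if "\<iota> \<in> I" for \<iota> using that K by (auto simp: I_def j_def)
      show "0 < size \<iota>" if "\<iota> \<in> I" for \<iota>
      proof (cases \<iota>)
        case (Inl x)
        then show ?thesis using D by (simp add: size_def)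
      next
        case (Inr S')
        then have "1 \<le> \<eta> * real (card S')" using that S by (auto simp: I_def)
        then have "card S' \<noteq> 0" by (intro notI) simp
        then show ?thesis by (simp add: size_def Inr)
      qed
      show "real (card {A\<in>F \<iota>. y \<in> A}) \<le> \<eta> * size \<iota>" if \<iota>: "\<iota> \<in> I" and y: "y \<in> V" for \<iota> y
      proof (cases \<iota>)
        case (Inl x)
        show ?thesis
        proof (cases "y = x")
          case True
          then have "{A\<in>F \<iota>. y \<in> A} = {}" by (auto simp: F_def Inl)
          then show ?thesis using \<eta>0 D by (simp only: size_def Inl) simp
        next
          case False
          have "{A\<in>F \<iota>. y \<in> A} \<subseteq> (\<lambda>e. e - {x}) ` {e\<in>H. x \<in> e \<and> y \<in> e}" by (auto simp: F_def Inl)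
          then have "card {A\<in>F \<iota>. y \<in> A} \<le> card {e\<in>H. x \<in> e \<and> y \<in> e}"
            by (rule surj_card_le[rotated]) (use fH in simp)
          moreover have "real (card {e\<in>H. x \<in> e \<and> y \<in> e}) \<le> \<eta> * D" using codeg False[symmetric] by blast
          ultimately show ?thesis by (simp add: size_def Inl)
        qed
      next
        case (Inr S')
        have "{A\<in>F \<iota>. y \<in> A} \<subseteq> {{y}}" by (auto simp: F_def Inr)
        then have "card {A\<in>F \<iota>. y \<in> A} \<le> 1" using card_mono[of "{{y}}"] by fastforce
        moreover have "1 \<le> \<eta> * real (card S')" using S \<iota> by (auto simp: I_def Inr)
        ultimately show ?thesis by (simp add: size_def Inr)
      qed
      show "\<exists>\<iota>\<in>I. size \<iota> = D \<and> j \<iota> = K - 1 \<and> F \<iota> = (\<lambda>e. e - {x}) ` {e\<in>H. x \<in> e}" if "x \<in> V" for x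
        by (rule bexI[of _ "Inl x"]) (use that in \<open>auto simp: size_def j_def F_def I_def\<close>)
    qed
    define \<phi> where "\<phi> = (real K)\<^sup>2 / (e * N)"
    have \<phi>\<eta>: "\<phi> \<le> (real K)\<^sup>2 * \<eta> / e"
    proof -
      have "(real K)\<^sup>2 / e * 1 \<le> (real K)\<^sup>2 / e * (\<eta> * N)"
        using V1 e by (intro mult_left_mono) (auto simp: N_def)
      then have "(real K)\<^sup>2 / e * 1 / N \<le> (real K)\<^sup>2 / e * (\<eta> * N) / N"
        using N0 by (intro divide_right_mono) auto
      then show ?thesis using N0 by (simp add: \<phi>_def)
    qed
    have \<phi>0: "0 < \<phi>" using K0 e N0 by (simp add: \<phi>_def)
    have \<phi>h: "\<phi> \<le> 1/2"
    proof -
      have "\<eta> \<le> e / (2 * (real K)\<^sup>2)" using \<eta>le cle by linarith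
      then have "(real K)\<^sup>2 * \<eta> / e \<le> 1/2" using K0 e by (simp add: field_simps)
      then show ?thesis using \<phi>\<eta> by linarith
    qed
    \<comment> \<open>After \<open>m\<close> steps between \<open>e N\<close> and \<open>2 e N\<close> vertices are left; with the final tolerance, a test
      set then keeps at most \<open>4 e = \<epsilon>\<close> of its elements.\<close>
    define m where "m = nat \<lfloor>(1 - e) * N / real K\<rfloor>"
    have mN: "real m \<le> (1 - e) * N / real K"
      unfolding m_def using e N0 K0 by (intro of_nat_floor) auto
    have mN': "(1 - e) * N / real K < real m + 1" unfolding m_def by linarith
    have mK: "real m * real K \<le> (1 - e) * N" using mN K0 by (simp add: field_simps)
    have mK': "(1 - e) * N < real m * real K + real K" using mN' K0 by (simp add: field_simps)
    have \<phi>m: "\<phi> * real m \<le> real K / e"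
    proof -
      have "real m \<le> N / real K"
      proof -
        have "(1 - e) * N \<le> 1 * N" using e N0 by (intro mult_right_mono) auto
        then show ?thesis using mN K0 divide_right_mono[of "(1 - e) * N" "1 * N" "real K"] by simp
      qed
      then have "\<phi> * real m \<le> \<phi> * (N / real K)" using \<phi>0 by (intro mult_left_mono) auto
      also have "\<dots> = real K / e" using N0 K0 e by (simp add: \<phi>_def power2_eq_square)
      finally show ?thesis .
    qed
    define u where "u = (\<lambda>i::nat. real (card V) - real i * real K)"
    have u: "e * N \<le> u l" if "l < m" for l
    proof -
      have "real l * real K \<le> real m * real K" using that by (intro mult_right_mono) auto
      then show ?thesis using mK by (simp add: u_def N_def algebra_simps)
    qed
    define n where "n = (\<lambda>(i::nat) (a::nat). \<Prod>l<i. 1 - real a * real K / u l)"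
    have eN: "0 < e * N" using e N0 by simp
    have n_ge: "c0 \<le> n i a" if i: "i \<le> m" and a: "a \<le> K" for i a
    proof -
      have each: "exp (- 2 * \<phi>) \<le> 1 - real a * real K / u l" if l: "l \<in> {..<i}" for l
      proof -
        have ul: "e * N \<le> u l" using u l i by auto
        have "real a * real K / u l \<le> (real K)\<^sup>2 / (e * N)"
          unfolding power2_eq_square using a ul eN by (intro frac_le mult_right_mono) auto
        then have x: "0 \<le> real a * real K / u l" "real a * real K / u l \<le> \<phi>"
          using ul eN by (auto simp: \<phi>_def)
        have "exp (- 2 * \<phi>) \<le> 1 - \<phi>" using \<phi>0 \<phi>h by (intro exp_minus_double_le) auto
        then show ?thesis using x by linarith
      qed
      have "c0 \<le> exp (- 2 * \<phi> * real i)"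
      proof -
        have "\<phi> * real i \<le> \<phi> * real m" using i \<phi>0 by (intro mult_left_mono) auto
        then show ?thesis using \<phi>m by (simp add: c0_def)
      qed
      also have "\<dots> = (\<Prod>l<i. exp (- 2 * \<phi>))" by (simp add: exp_of_nat_mult[symmetric] mult.commute)
      also have "\<dots> \<le> n i a" unfolding n_def by (rule prod_mono) (use each in auto)
      finally show ?thesis .
    qed
    have grow: "\<delta> * (1 + 30 * \<phi>) ^ m \<le> 1/5"
    proof -
      have "(1 + 30 * \<phi>) ^ m \<le> exp (30 * \<phi>) ^ m" using \<phi>0 by (intro power_mono exp_ge_add_one_self) auto
      also have "\<dots> = exp (30 * (\<phi> * real m))" by (simp add: exp_of_nat_mult[symmetric] ac_simps)
      also have "\<dots> \<le> exp (30 * real K / e)" using \<phi>m by simp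
      finally have "\<delta> * (1 + 30 * \<phi>) ^ m \<le> \<delta> * exp (30 * real K / e)" using \<delta>0 by (intro mult_left_mono) auto
      also have "\<dots> = 1/5" by (simp add: \<delta>_def flip: exp_add)
      finally show ?thesis .
    qed
    define \<alpha> where "\<alpha> = 2 / \<delta> * L"
    define \<beta> where "\<beta> = B * \<eta>"
    have \<alpha>0: "0 < \<alpha>" using \<delta>0 L1 by (simp add: \<alpha>_def)
    have small: "(real K)\<^sup>2 * \<eta> \<le> \<delta> * c0"
    proof -
      have "\<eta> \<le> \<delta> * c0 / (real K)\<^sup>2" using \<eta>le cle by linarith
      then show ?thesis using K0 by (simp add: field_simps)
    qed
    have \<beta>1: "4 * \<phi> \<le> \<beta>"
    proof -
      have "0 \<le> 2 * real K / c0 * \<eta>" using c00 \<eta>0 by simp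
      moreover have "4 * \<phi> \<le> 4 * (real K)\<^sup>2 / e * \<eta>" using \<phi>\<eta> by simp
      ultimately show ?thesis unfolding \<beta>_def B_def distrib_right by linarith
    qed
    have \<beta>2: "2 * real K * \<eta> / c0 \<le> \<beta>"
      using e \<eta>0 by (simp add: \<beta>_def B_def algebra_simps)
    have \<beta>3: "\<alpha> * \<beta> \<le> \<delta>"
    proof -
      have "\<alpha> * \<beta> = 2 * B / \<delta> * (\<eta> * L)" by (simp add: \<alpha>_def \<beta>_def)
      also have "\<dots> \<le> 2 * B / \<delta> * (\<delta>\<^sup>2 / (2 * B))"
        using \<eta>L cle(2) B0 \<delta>0 by (intro mult_left_mono) auto
      also have "\<dots> = \<delta>" using B0 \<delta>0 by (simp add: power2_eq_square)
      finally show ?thesis .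
    qed
    have cI: "card I = card V + card \<S>" using fV fS by (simp add: I_def card_Plus)
    have expL: "exp (- L) = 1 / (2 * real (card I) + 1)"
      by (simp add: L_def exp_minus cI field_simps add_pos_nonneg)
    have init1: "pot \<alpha> \<delta> (real (card (F \<iota>)) / size \<iota>) \<le> 2 * exp (- L)" if \<iota>: "\<iota> \<in> I" for \<iota>
    proof -
      define X where "X = real (card (F \<iota>)) / size \<iota>"
      have "\<bar>X - 1\<bar> \<le> \<delta> / 2"
      proof (cases \<iota>)
        case (Inl x)
        then have x: "x \<in> V" using \<iota> by (auto simp: I_def)
        have "X = real (card {e\<in>H. x \<in> e}) / D"
          using card_image[OF inj[of x]] by (simp add: X_def F_def size_def Inl)
        then have "\<bar>X - 1\<bar> = \<bar>real (card {e\<in>H. x \<in> e}) - D\<bar> / D"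
          using D abs_divide[of "real (card {e\<in>H. x \<in> e}) - D" D] by (simp add: diff_divide_distrib)
        also have "\<dots> \<le> c * D / D" using deg x D by (intro divide_right_mono) auto
        finally show ?thesis using cle(1) D by simp
      next
        case (Inr S')
        have "card ((\<lambda>y. {y}) ` S') = card S'" by (intro card_image) (auto simp: inj_on_def)
        then have "X = 1" using size_pos[OF \<iota>] by (simp add: X_def F_def size_def Inr)
        then show ?thesis using \<delta>0 by simp
      qed
      then have "X - 1 - \<delta> \<le> - \<delta> / 2" "1 - \<delta> - X \<le> - \<delta> / 2" by linarith+
      then have "\<alpha> * (X - 1 - \<delta>) \<le> \<alpha> * (- \<delta> / 2)" "\<alpha> * (1 - \<delta> - X) \<le> \<alpha> * (- \<delta> / 2)"
        using \<alpha>0 by (auto simp only: mult_le_cancel_left_pos)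
      moreover have "\<alpha> * (- \<delta> / 2) = - L" using \<delta>0 by (simp add: \<alpha>_def)
      ultimately have "exp (\<alpha> * (X - 1 - \<delta>)) \<le> exp (- L)" "exp (\<alpha> * (1 - \<delta> - X)) \<le> exp (- L)" by simp_all
      then show ?thesis unfolding X_def[symmetric] pot_def by linarith
    qed
    have init: "(\<Sum>\<iota>\<in>I. pot \<alpha> \<delta> (real (card (F \<iota>)) / size \<iota>)) < 1"
    proof -
      have "(\<Sum>\<iota>\<in>I. pot \<alpha> \<delta> (real (card (F \<iota>)) / size \<iota>)) \<le> (\<Sum>\<iota>\<in>I. 2 * exp (- L))"
        by (rule sum_mono) (rule init1)
      also have "\<dots> = 2 * real (card I) / (2 * real (card I) + 1)" by (simp add: expL)
      also have "\<dots> < 1" by (simp add: divide_less_eq)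
      finally show ?thesis .
    qed
    have V0: "0 < card V" using N0 by (simp add: N_def)
    obtain M where M: "M \<subseteq> H" "\<forall>e\<in>M. \<forall>f\<in>M. e \<noteq> f \<longrightarrow> e \<inter> f = {}"
      and P: "(\<Sum>\<iota>\<in>I. pot \<alpha> (\<delta> * (1 + 30 * \<phi>) ^ m) (ratio (n m) (\<Union>M) \<iota>)) < 1"
      using greedy_run[OF e(1) V0, of \<phi> m \<delta> c0 \<alpha> \<beta> m] \<phi>h u \<delta>0(1) grow c00 n_ge small \<alpha>0 \<beta>1 \<beta>2 \<beta>3 init
      unfolding n_def u_def \<phi>_def N_def by auto
    define C where "C = \<Union>M"
    \<comment> \<open>For singletons the product defining \<open>n\<close> telescopes to the proportion of uncovered vertices.\<close>
    have n1: "n i 1 = u i / N" if "i \<le> m" for i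
      using that
    proof (induction i)
      case 0
      then show ?case using N0 by (simp add: n_def u_def N_def)
    next
      case (Suc i)
      have "0 < u i" using u[of i] eN Suc.prems by auto
      have "n (Suc i) 1 = n i 1 * (1 - real K / u i)" by (simp add: n_def)
      also have "\<dots> = (u i / N) * (1 - real K / u i)" using Suc by simp
      also have "\<dots> = u i * (1 - real K / u i) / N" by simp
      also have "u i * (1 - real K / u i) = u i - real K" using \<open>0 < u i\<close> by (simp add: right_diff_distrib)
      also have "u i - real K = u (Suc i)" by (simp add: u_def algebra_simps)
      finally show ?case .
    qed
    have nm: "n m 1 \<le> 2 * e" "0 < n m 1"
    proof -
      have "(real K)\<^sup>2 \<le> e * N / 2" using \<phi>h eN by (simp add: \<phi>_def divide_le_eq)
      moreover have "real K \<le> (real K)\<^sup>2" using K by (simp add: power2_eq_square)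
      ultimately have "real K \<le> e * N" using eN by linarith
      then have "u m \<le> 2 * e * N" using mK' by (simp add: u_def N_def algebra_simps)
      then show "n m 1 \<le> 2 * e" using n1[of m] N0 by (simp add: divide_le_eq)
      show "0 < n m 1" using n_ge[of m 1] c00 K by linarith
    qed
    show "\<exists>M\<subseteq>H. (\<forall>e\<in>M. \<forall>f\<in>M. e \<noteq> f \<longrightarrow> e \<inter> f = {}) \<and>
      (\<forall>S\<in>\<S>. real (card (S - \<Union>M)) \<le> \<epsilon> * real (card S))"
    proof (intro exI[of _ M] conjI M ballI[of \<S>])
      fix S' assume S': "S' \<in> \<S>"
      define \<iota> where "\<iota> = (Inr S' :: 'v + 'v set)"
      have \<iota>: "\<iota> \<in> I" using S' by (auto simp: \<iota>_def I_def)
      have "pot \<alpha> (\<delta> * (1 + 30 * \<phi>) ^ m) (ratio (n m) C \<iota>)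
          \<le> (\<Sum>\<iota>\<in>I. pot \<alpha> (\<delta> * (1 + 30 * \<phi>) ^ m) (ratio (n m) C \<iota>))"
        using \<iota> fin_I pot_nonneg by (intro member_le_sum) auto
      then have "pot \<alpha> (\<delta> * (1 + 30 * \<phi>) ^ m) (ratio (n m) C \<iota>) < 1" using P by (simp add: C_def)
      then have "\<bar>ratio (n m) C \<iota> - 1\<bar> \<le> \<delta> * (1 + 30 * \<phi>) ^ m" by (rule pot_less_one[OF _ \<alpha>0])
      then have r: "ratio (n m) C \<iota> \<le> 2" using grow by linarith
      have "alive C \<iota> = (\<lambda>y. {y}) ` (S' - C)" unfolding alive_def unfolding F_def \<iota>_def by auto
      then have "card (alive C \<iota>) = card (S' - C)" by (simp add: card_image inj_on_def)
      moreover have sj: "size \<iota> = real (card S')" "j \<iota> = 1" by (simp_all add: size_def j_def \<iota>_def)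
      ultimately have "real (card (S' - C)) / (real (card S') * n m 1) \<le> 2"
        using r unfolding ratio_def sj by simp
      moreover have pos: "0 < real (card S')" using size_pos[OF \<iota>] by (simp add: size_def \<iota>_def)
      ultimately have "real (card (S' - C)) \<le> 2 * (real (card S') * n m 1)"
        using nm(2) by (simp add: divide_le_eq)
      also have "\<dots> \<le> 2 * (real (card S') * (2 * e))" using nm by (intro mult_left_mono) auto
      finally show "real (card (S' - \<Union>M)) \<le> \<epsilon> * real (card S')" by (simp add: C_def e_def ac_simps)
    qed
  qed
qed

section \<open>Colored blocks that cover all sets of size k\<close>

lemma card_nsets_eq: "finite A \<Longrightarrow> card (nsets A k) = card A choose k"
  by (simp add: nsets_def n_subsets[symmetric] conj_commute)
     (rule arg_cong[of _ _ card], auto dest: finite_subset)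

lemma card_nsets_supersets:
  assumes A: "finite A" and T: "T \<subseteq> A" "card T \<le> m"
  shows "card {B\<in>nsets A m. T \<subseteq> B} = (card A - card T) choose (m - card T)"
proof -
  have fT: "finite T" using A T finite_subset by blast
  have "bij_betw (\<lambda>B. B - T) {B\<in>nsets A m. T \<subseteq> B} (nsets (A - T) (m - card T))"
  proof (rule bij_betwI[where g = "\<lambda>B. B \<union> T"])
    show "(\<lambda>B. B - T) \<in> {B\<in>nsets A m. T \<subseteq> B} \<rightarrow> nsets (A - T) (m - card T)"
      using fT by (auto simp: nsets_def card_Diff_subset)
    show "(\<lambda>B. B \<union> T) \<in> nsets (A - T) (m - card T) \<rightarrow> {B\<in>nsets A m. T \<subseteq> B}"
    proof
      fix B assume B: "B \<in> nsets (A - T) (m - card T)"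
      then have "card (B \<union> T) = (m - card T) + card T"
        using fT by (subst card_Un_disjoint) (auto simp: nsets_def)
      then show "B \<union> T \<in> {B\<in>nsets A m. T \<subseteq> B}" using B T fT by (auto simp: nsets_def)
    qed
  qed (auto simp: nsets_def)
  then have "card {B\<in>nsets A m. T \<subseteq> B} = card (nsets (A - T) (m - card T))"
    by (rule bij_betw_same_card)
  also have "\<dots> = (card A - card T) choose (m - card T)"
    using A T fT by (simp add: card_nsets_eq card_Diff_subset)
  finally show ?thesis .
qed

lemma card_nsets_supersets_le:
  assumes A: "finite A" and U: "l \<le> card U" "l \<le> m" "l \<le> card A"
  shows "card {B\<in>nsets A m. U \<subseteq> B} \<le> (card A - l) choose (m - l)"
proof (cases "U \<subseteq> A")
  case True
  obtain T where T: "T \<subseteq> U" "card T = l" using U(1) obtain_subset_with_card_n by metis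
  have "card {B\<in>nsets A m. U \<subseteq> B} \<le> card {B\<in>nsets A m. T \<subseteq> B}"
    using A T finite_imp_finite_nsets[OF A] by (intro card_mono) auto
  also have "\<dots> = (card A - l) choose (m - l)"
    using card_nsets_supersets[OF A, of T m] T True U by auto
  finally show ?thesis .
next
  case False
  then have "{B\<in>nsets A m. U \<subseteq> B} = {}" by (auto simp: nsets_def)
  then show ?thesis by (metis card.empty zero_le)
qed

lemma greedy_coloring:
  assumes "finite U" and sym: "\<And>x y. R x y \<Longrightarrow> R y x"
    and deg: "\<And>x. x \<in> U \<Longrightarrow> card {y\<in>U. R x y} \<le> d"
  shows "\<exists>g :: 'a \<Rightarrow> nat. (\<forall>x\<in>U. g x \<le> d) \<and> (\<forall>x\<in>U. \<forall>y\<in>U. x \<noteq> y \<longrightarrow> R x y \<longrightarrow> g x \<noteq> g y)"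
  using assms(1) deg
proof (induction U rule: finite_induct)
  case empty
  then show ?case by simp
next
  case (insert a U)
  have "card {y\<in>U. R x y} \<le> d" if "x \<in> U" for x
  proof -
    have "card {y\<in>U. R x y} \<le> card {y\<in>insert a U. R x y}"
      using insert.hyps(1) by (intro card_mono) auto
    then show ?thesis using insert.prems[of x] that by auto
  qed
  then obtain g :: "'a \<Rightarrow> nat" where g: "\<forall>x\<in>U. g x \<le> d" "\<forall>x\<in>U. \<forall>y\<in>U. x \<noteq> y \<longrightarrow> R x y \<longrightarrow> g x \<noteq> g y"
    using insert.IH by auto
  have "card (g ` {y\<in>U. R a y}) \<le> card {y\<in>U. R a y}" using insert.hyps(1) by (intro card_image_le) auto
  also have "\<dots> \<le> card {y\<in>insert a U. R a y}" using insert.hyps(1) by (intro card_mono) auto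
  also have "\<dots> \<le> d" using insert.prems by auto
  also have "\<dots> < card {..d}" by simp
  finally have "\<not> {..d} \<subseteq> g ` {y\<in>U. R a y}"
    using insert.hyps(1) card_mono[of "g ` {y\<in>U. R a y}" "{..d}"] by auto
  then obtain c where c: "c \<le> d" "c \<notin> g ` {y\<in>U. R a y}" by auto
  have "\<forall>x\<in>insert a U. \<forall>y\<in>insert a U. x \<noteq> y \<longrightarrow> R x y \<longrightarrow> (g(a := c)) x \<noteq> (g(a := c)) y"
  proof (intro ballI impI)
    fix x y assume "x \<in> insert a U" "y \<in> insert a U" and xy: "x \<noteq> y" "R x y"
    then consider "x = a" "y \<in> U" | "y = a" "x \<in> U" | "x \<in> U" "y \<in> U" by auto
    then show "(g(a := c)) x \<noteq> (g(a := c)) y"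
    proof cases
      case 1
      then have "g y \<in> g ` {y\<in>U. R a y}" using xy by blast
      then show ?thesis using 1 c(2) xy(1) by force
    next
      case 2
      then have "g x \<in> g ` {y\<in>U. R a y}" using sym[OF xy(2)] by blast
      then have "g x \<noteq> c" using c(2) by metis
      then show ?thesis using 2 xy(1) by simp
    next
      case 3
      then have "x \<noteq> a" "y \<noteq> a" using insert.hyps(2) by auto
      then show ?thesis using g(2) xy 3 by simp
    qed
  qed
  then show ?case using g(1) c(1) by (intro exI[of _ "g(a := c)"]) auto
qed

text \<open>The star of a block \<open>B\<close> with color \<open>a\<close> consists of the slots that the colored block occupies:
  all \<open>k\<close>-sets in \<open>B\<close>, and each \<open>t\<close>-set in \<open>B\<close> together with \<open>a\<close>. A \<open>k\<close>-set is tagged with \<open>0\<close>,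
  which is not a color. Stars are disjoint if and only if the blocks have no common \<open>k\<close>-set and,
  in the case of equal colors, no common \<open>t\<close>-set.\<close>
locale block_stars =
  fixes t k b v r :: nat
  assumes params: "1 \<le> t" "t < k" "k < b" "b < v" and r_pos: "1 \<le> r"
begin

definition star :: "nat set \<Rightarrow> nat \<Rightarrow> (nat set \<times> nat) set" where
  "star B a = nsets B k \<times> {0} \<union> nsets B t \<times> {a}"

definition stars where
  "stars = (\<lambda>(B, a). star B a) ` (nsets {..<v} b \<times> {1..r})"

definition slots where
  "slots = nsets {..<v} k \<times> {0} \<union> nsets {..<v} t \<times> {1..r}"

lemma finite_slots: "finite slots"
  by (simp add: slots_def finite_imp_finite_nsets)

lemma star_in_slots:
  assumes "e \<in> stars"
  shows "e \<subseteq> slots \<and> card e = (b choose k) + (b choose t)"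
proof -
  obtain B a where B: "B \<in> nsets {..<v} b" and a: "a \<in> {1..r}" and e: "e = star B a"
    using assms by (auto simp: stars_def)
  have fB: "finite B" "card B = b" "B \<subseteq> {..<v}" using B by (auto simp: nsets_def)
  have "card e = card (nsets B k \<times> {0::nat}) + card (nsets B t \<times> {a})"
    unfolding e star_def using a fB by (intro card_Un_disjoint) (auto simp: finite_imp_finite_nsets)
  moreover have "e \<subseteq> slots" unfolding e star_def slots_def using a fB nsets_mono[OF fB(3)] by blast
  ultimately show ?thesis using fB by (simp add: card_cartesian_product card_nsets_eq)
qed

lemma in_star_iff:
  assumes "a \<in> {1..r}"
  shows "(S, i) \<in> star B a \<longleftrightarrow> (if i = 0 then S \<in> nsets B k else S \<in> nsets B t \<and> i = a)"
  using assms by (auto simp: star_def)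

lemma inj_star: "inj_on (\<lambda>(B, a). star B a) (nsets {..<v} b \<times> {1..r})"
proof (rule inj_onI, clarsimp)
  fix B a B' a' assume B: "B \<in> nsets {..<v} b" "B' \<in> nsets {..<v} b"
    and a: "Suc 0 \<le> a" "a \<le> r" "Suc 0 \<le> a'" "a' \<le> r" and eq: "star B a = star B' a'"
  have sub: "X \<subseteq> Y \<and> c = d" if "star X c = star Y d" "X \<in> nsets {..<v} b" "c \<in> {1..r}" "d \<in> {1..r}" for X Y c d
  proof -
    have X: "finite X" "card X = b" using that by (auto simp: nsets_def)
    have "\<exists>T\<in>nsets X t. x \<in> T" if "x \<in> X" for x
    proof -
      have "t - 1 \<le> card (X - {x})" using X that params by simp
      then obtain T where "T \<subseteq> X - {x}" "card T = t - 1" "finite T" using obtain_subset_with_card_n by metis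
      moreover have "x \<notin> T" using calculation by blast
      ultimately have "insert x T \<in> nsets X t" using that params by (auto simp: nsets_def)
      then show ?thesis by blast
    qed
    moreover have "T \<in> nsets Y t \<and> c = d" if "T \<in> nsets X t" for T
    proof -
      have "(T, c) \<in> star X c" using that by (simp add: star_def)
      then show ?thesis using \<open>star X c = star Y d\<close> in_star_iff[OF \<open>d \<in> {1..r}\<close>, of T c Y] \<open>c \<in> {1..r}\<close> by auto
    qed
    moreover have "X \<noteq> {}" using X params by auto
    ultimately show ?thesis by (auto simp: nsets_def)
  qed
  show "B = B' \<and> a = a'" using sub[OF eq] sub[OF eq[symmetric]] B a by auto
qed

lemma card_stars_filter:
  "card {e\<in>stars. P e} = card {(B, a). B \<in> nsets {..<v} b \<and> a \<in> {1..r} \<and> P (star B a)}"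
proof -
  have "{e\<in>stars. P e} = (\<lambda>(B, a). star B a) ` {(B, a). B \<in> nsets {..<v} b \<and> a \<in> {1..r} \<and> P (star B a)}"
    by (auto simp: stars_def)
  then show ?thesis
    by (simp only:) (intro card_image inj_on_subset[OF inj_star], auto)
qed

lemma degree_k:
  assumes "S \<in> nsets {..<v} k"
  shows "card {e\<in>stars. (S, 0) \<in> e} = ((v - k) choose (b - k)) * r"
proof -
  have S: "S \<subseteq> {..<v}" "card S = k" "finite S" using assms by (auto simp: nsets_def)
  have n: "S \<in> nsets B k \<longleftrightarrow> S \<subseteq> B" for B using S by (auto simp: nsets_def)
  have "{(B, a). B \<in> nsets {..<v} b \<and> a \<in> {1..r} \<and> (S, 0) \<in> star B a} = {B\<in>nsets {..<v} b. S \<subseteq> B} \<times> {1..r}"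
    by (auto simp: in_star_iff n)
  then show ?thesis
    unfolding card_stars_filter using S params
    by (simp only: card_cartesian_product) (simp add: card_nsets_supersets)
qed

lemma degree_t:
  assumes "T \<in> nsets {..<v} t" "i \<in> {1..r}"
  shows "card {e\<in>stars. (T, i) \<in> e} = (v - t) choose (b - t)"
proof -
  have S: "T \<subseteq> {..<v}" "card T = t" "finite T" using assms by (auto simp: nsets_def)
  have n: "T \<in> nsets B t \<longleftrightarrow> T \<subseteq> B" for B using S by (auto simp: nsets_def)
  have "{(B, a). B \<in> nsets {..<v} b \<and> a \<in> {1..r} \<and> (T, i) \<in> star B a} = {B\<in>nsets {..<v} b. T \<subseteq> B} \<times> {i}"
    using assms(2) by (auto simp: in_star_iff n)
  then show ?thesis
    unfolding card_stars_filter using S params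
    by (simp only: card_cartesian_product) (simp add: card_nsets_supersets)
qed

text \<open>Two distinct slots that lie in a common star always restrict it further: either the block
  must contain \<open>k + 1\<close> given points, or its color is determined and it must contain \<open>t + 1\<close> given
  points.\<close>
lemma codegree:
  assumes ne: "x \<noteq> y"
  shows "card {e\<in>stars. x \<in> e \<and> y \<in> e}
    \<le> max (((v - Suc k) choose (b - Suc k)) * r) ((v - Suc t) choose (b - Suc t))"
proof -
  obtain S i S' i' where xy: "x = (S, i)" "y = (S', i')" by (cases x, cases y)
  define P where "P = {(B, a). B \<in> nsets {..<v} b \<and> a \<in> {1..r} \<and> x \<in> star B a \<and> y \<in> star B a}"
  have fP: "finite (nsets {..<v} b)" by (simp add: finite_imp_finite_nsets)
  have cu: "Suc m \<le> card (S \<union> S')" if "card S = m" "card S' = m" "finite S" "finite S'" "S \<noteq> S'" for m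
  proof -
    have "\<not> S' \<subseteq> S" using that card_subset_eq by metis
    then have "S \<subset> S \<union> S'" by auto
    then show ?thesis using that psubset_card_mono[of "S \<union> S'" S] by auto
  qed
  have "card P \<le> max (((v - Suc k) choose (b - Suc k)) * r) ((v - Suc t) choose (b - Suc t))"
  proof (cases "P = {}")
    case True
    then show ?thesis by simp
  next
    case False
    then obtain B0 a0 where P0: "(B0, a0) \<in> P" by auto
    have sup: "card {B\<in>nsets {..<v} b. U \<subseteq> B} \<le> (v - Suc t) choose (b - Suc t)" if "Suc t \<le> card U" for U
      using card_nsets_supersets_le[of "{..<v}" "Suc t" U b] that params by simp
    show ?thesis
    proof (cases "i = 0 \<and> i' = 0")
      case True
      then have S: "card S = k" "card S' = k" "finite S" "finite S'" "S \<noteq> S'"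
        using P0 ne by (auto simp: P_def xy in_star_iff nsets_def)
      have "P \<subseteq> {B\<in>nsets {..<v} b. S \<union> S' \<subseteq> B} \<times> {1..r}"
        using True by (auto simp: P_def xy in_star_iff nsets_def)
      then have "card P \<le> card {B\<in>nsets {..<v} b. S \<union> S' \<subseteq> B} * r"
        using fP card_mono[of "{B\<in>nsets {..<v} b. S \<union> S' \<subseteq> B} \<times> {1..r}" P]
        by (simp add: card_cartesian_product)
      also have "\<dots> \<le> ((v - Suc k) choose (b - Suc k)) * r"
        using card_nsets_supersets_le[of "{..<v}" "Suc k" "S \<union> S'" b] cu[OF S] params
        by (intro mult_right_mono) auto
      finally show ?thesis by linarith
    next
      case False
      \<comment> \<open>A coordinate carrying a colour fixes the colour of the star.\<close>
      have "\<exists>U. Suc t \<le> card U \<and> P \<subseteq> {B\<in>nsets {..<v} b. U \<subseteq> B} \<times> {a0}"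
      proof (cases "i = 0 \<or> i' = 0")
        case True
        define U where "U = (if i = 0 then S else S')"
        have "Suc t \<le> card U" using P0 True params by (auto simp: P_def xy in_star_iff nsets_def U_def split: if_splits)
        moreover have "P \<subseteq> {B\<in>nsets {..<v} b. U \<subseteq> B} \<times> {a0}"
          using P0 True False by (auto simp: P_def xy in_star_iff nsets_def U_def split: if_splits)
        ultimately show ?thesis by blast
      next
        case nz: False
        then have S: "card S = t" "card S' = t" "finite S" "finite S'" "S \<noteq> S'"
          using P0 ne by (auto simp: P_def xy in_star_iff nsets_def)
        have "P \<subseteq> {B\<in>nsets {..<v} b. S \<union> S' \<subseteq> B} \<times> {a0}"
          using P0 nz by (auto simp: P_def xy in_star_iff nsets_def)
        then show ?thesis using cu[OF S] by blast
      qed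
      then obtain U where U: "Suc t \<le> card U" "P \<subseteq> {B\<in>nsets {..<v} b. U \<subseteq> B} \<times> {a0}" by blast
      have "card P \<le> card ({B\<in>nsets {..<v} b. U \<subseteq> B} \<times> {a0})"
        using U(2) fP by (intro card_mono) auto
      then show ?thesis using sup[OF U(1)] by (simp add: card_cartesian_product)
    qed
  qed
  then show ?thesis unfolding card_stars_filter P_def .
qed

end

lemma binomial_diag_mono: "n choose m \<le> (n + d) choose (m + d)"
  by (induction d) (auto intro: order_trans)

lemma binomial_pred:
  assumes "1 \<le> m" "1 \<le> n"
  shows "real ((n - 1) choose (m - 1)) = real m / real n * real (n choose m)"
proof -
  obtain n' m' where "n = Suc n'" "m = Suc m'" using assms by (metis Suc_le_D One_nat_def)
  moreover have "real (Suc n') * real (n' choose m') = real (Suc n' choose Suc m') * real (Suc m')"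
    using Suc_times_binomial_eq[of n' m'] by (metis of_nat_mult)
  ultimately show ?thesis by (simp add: field_simps del: of_nat_Suc binomial_Suc_Suc)
qed

text \<open>The number of colors \<open>r\<close> is chosen such that both kinds of slots have almost the same degree \<open>D\<close>
  in the hypergraph of stars. Testing a matching against all \<open>k\<close>-sets above a given \<open>t\<close>-set
  shows that an uncovered \<open>k\<close>-set shares \<open>t\<close> points with few other uncovered ones, so that these
  sets can be colored greedily with at most \<open>d + 1\<close> further colors. The
  quotient \<open>\<eta> v\<close> of codegrees and degrees is of order \<open>1 / v\<close>, while the number of slots and tests
  is polynomial in \<open>v\<close>, so the logarithmic condition of \<open>near_perfect_matching\<close> holds for large
  \<open>v\<close>.\<close>
lemma tight_block_coloring:
  fixes t k b :: nat and \<delta> :: real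
  assumes tk: "1 \<le> t" "t < k" "k < b" and \<delta>: "0 < \<delta>"
  shows "\<forall>\<^sub>F v in sequentially. \<exists>(\<beta> :: nat set \<Rightarrow> nat set) (\<gamma> :: nat set \<Rightarrow> nat).
    (\<forall>e\<in>nsets {..<v} k. e \<subseteq> \<beta> e \<and> finite (\<beta> e) \<and> card (\<beta> e) \<le> b \<and> 1 \<le> \<gamma> e \<and>
      real (\<gamma> e) \<le> (1 + \<delta>) * (real ((v - t) choose (k - t)) / real ((b - t) choose (k - t)))) \<and>
    (\<forall>e\<in>nsets {..<v} k. \<forall>f\<in>nsets {..<v} k. \<gamma> e = \<gamma> f \<longrightarrow> t \<le> card (e \<inter> f) \<longrightarrow> \<beta> e = \<beta> f)"
proof -
  define K where "K = (b choose k) + (b choose t)"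
  define Q where "Q = real ((b - t) choose (k - t))"
  define P where "P = real (k choose t)"
  have Q1: "1 \<le> Q" using tk by (simp add: Q_def Suc_le_eq)
  have P1: "1 \<le> P" using tk by (simp add: P_def Suc_le_eq)
  have K1: "1 \<le> K" using tk by (simp add: K_def Suc_le_eq)
  define \<epsilon> where "\<epsilon> = min 1 (\<delta> / (2 * P * Q))"
  have \<epsilon>: "0 < \<epsilon>" "\<epsilon> \<le> 1" using \<delta> P1 Q1 by (auto simp: \<epsilon>_def)
  have \<epsilon>PQ: "P * \<epsilon> * Q \<le> \<delta> / 2"
  proof -
    have "P * Q * \<epsilon> \<le> P * Q * (\<delta> / (2 * P * Q))" using P1 Q1 by (intro mult_left_mono) (auto simp: \<epsilon>_def)
    also have "\<dots> = \<delta> / 2" using P1 Q1 by simp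
    finally show ?thesis by (simp add: ac_simps)
  qed
  obtain c where c: "0 < c" and npm: "\<And>(V :: (nat set \<times> nat) set) H D \<eta> \<S>. \<lbrakk>finite V;
      \<forall>e\<in>H. e \<subseteq> V \<and> card e = K; 0 < D;
      \<forall>x\<in>V. \<bar>real (card {e\<in>H. x \<in> e}) - D\<bar> \<le> c * D;
      \<forall>x y. x \<noteq> y \<longrightarrow> real (card {e\<in>H. x \<in> e \<and> y \<in> e}) \<le> \<eta> * D;
      finite \<S>; \<forall>S\<in>\<S>. S \<subseteq> V \<and> 1 \<le> \<eta> * real (card S); 1 \<le> \<eta> * real (card V);
      \<eta> * ln (2 * real (card V + card \<S>) + 1) \<le> c\<rbrakk>
    \<Longrightarrow> \<exists>M\<subseteq>H. (\<forall>e\<in>M. \<forall>f\<in>M. e \<noteq> f \<longrightarrow> e \<inter> f = {}) \<and>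
      (\<forall>S\<in>\<S>. real (card (S - \<Union>M)) \<le> \<epsilon> * real (card S))"
    by (rule near_perfect_matching[OF K1 \<epsilon>, where 'v = "nat set \<times> nat"]) blast
  define \<eta> where "\<eta> = (\<lambda>v::nat. 2 * (real b / (real v - real k)))"
  have "(\<lambda>v. \<eta> v) \<longlonglongrightarrow> 0" unfolding \<eta>_def by real_asymp
  then have e1: "\<forall>\<^sub>F v in sequentially. \<eta> v < min (min c 1) (\<delta> / 4)"
    using c \<delta> by (intro order_tendstoD(2)) auto
  have "(\<lambda>v. \<eta> v * (ln 9 + real k * ln (real v))) \<longlonglongrightarrow> 0" unfolding \<eta>_def by real_asymp
  then have e2: "\<forall>\<^sub>F v in sequentially. \<eta> v * (ln 9 + real k * ln (real v)) < c"
    using c by (intro order_tendstoD(2)) auto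
  show ?thesis
    using eventually_gt_at_top[of b] e1 e2
  proof eventually_elim
    case (elim v)
    have v: "b < v" by fact
    have \<eta>c: "\<eta> v \<le> c" "\<eta> v \<le> 1" "\<eta> v \<le> \<delta> / 4" using elim by auto
    have vk: "0 < real v - real k" using v tk by linarith
    have \<eta>0: "0 < \<eta> v" using vk tk by (simp add: \<eta>_def)
    have \<eta>2: "\<eta> v / 2 = real b / (real v - real k)"
      unfolding \<eta>_def by (rule nonzero_mult_div_cancel_left) simp
    define R where "R = real ((v - t) choose (k - t))"
    define \<rho> where "\<rho> = R / Q"
    define D where "D = real ((v - t) choose (b - t))"
    define E where "E = real ((v - k) choose (b - k))"
    have R1: "1 \<le> R" using v tk by (simp add: R_def Suc_le_eq)
    have D0: "0 < D" using v tk by (simp add: D_def)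
    have E0: "0 < E" using v tk by (simp add: E_def)
    have DE: "D = \<rho> * E"
    proof -
      have "((v - t) choose (b - t)) * ((b - t) choose (k - t)) = ((v - t) choose (k - t)) * ((v - k) choose (b - k))"
        using choose_mult[of "k - t" "b - t" "v - t"] v tk by simp
      then have "D * Q = R * E" unfolding D_def Q_def R_def E_def by (metis of_nat_mult)
      then show ?thesis using Q1 by (simp add: \<rho>_def field_simps)
    qed
    have At: "real ((v - Suc t) choose (b - Suc t)) \<le> \<eta> v / 2 * D"
    proof -
      have "real ((v - Suc t) choose (b - Suc t)) = real (b - t) / real (v - t) * D"
        using binomial_pred[of "b - t" "v - t"] v tk by (simp add: D_def)
      also have "\<dots> \<le> \<eta> v / 2 * D"
      proof (intro mult_right_mono)
        have "real (b - t) / real (v - t) \<le> real b / (real v - real k)"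
          using v tk by (intro frac_le) auto
        then show "real (b - t) / real (v - t) \<le> \<eta> v / 2" unfolding \<eta>2 .
      qed (use D0 in simp)
      finally show ?thesis .
    qed
    have Ak: "real ((v - Suc k) choose (b - Suc k)) \<le> \<eta> v / 2 * E"
    proof -
      have "real ((v - Suc k) choose (b - Suc k)) = real (b - k) / real (v - k) * E"
        using binomial_pred[of "b - k" "v - k"] v tk by (simp add: E_def)
      also have "\<dots> \<le> \<eta> v / 2 * E"
      proof (intro mult_right_mono)
        have "real (b - k) / real (v - k) \<le> real b / (real v - real k)"
          using v tk by (intro frac_le) auto
        then show "real (b - k) / real (v - k) \<le> \<eta> v / 2" unfolding \<eta>2 .
      qed (use E0 in simp)
      finally show ?thesis .
    qed
    have EA: "E \<le> \<eta> v / 2 * D"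
    proof -
      have "(v - k) choose (b - k) \<le> (v - Suc t) choose (b - Suc t)"
        using binomial_diag_mono[of "v - k" "b - k" "k - Suc t"] v tk by simp
      then show ?thesis using At by (simp add: E_def)
    qed
    have \<rho>\<eta>: "1 \<le> \<eta> v / 2 * \<rho>"
    proof -
      have "1 * E \<le> (\<eta> v / 2 * \<rho>) * E" using EA DE by (simp add: ac_simps)
      then show ?thesis using E0 by (simp only: mult_le_cancel_right_pos)
    qed
    have \<rho>0: "0 < \<rho>" using Q1 R1 by (simp add: \<rho>_def)
    have "\<eta> v / 2 * \<rho> \<le> 1 * \<rho>" using \<eta>c(2) \<eta>0 \<rho>0 by (intro mult_right_mono) auto
    then have \<rho>1: "1 \<le> \<rho>" using \<rho>\<eta> by linarith
    define r where "r = nat \<lceil>\<rho>\<rceil>"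
    have r: "\<rho> \<le> real r" "real r \<le> \<rho> + 1" using \<rho>1 by (auto simp: r_def)
    then have r1: "1 \<le> r" using \<rho>1 by linarith
    interpret block_stars t k b v r
      by standard (use tk v r1 in auto)
    define V where "V = slots"
    define H where "H = stars"
    define Te where "Te = (\<lambda>T. {S\<in>nsets {..<v} k. T \<subseteq> S} \<times> {0::nat})"
    have cTe: "real (card (Te T)) = R" if "T \<in> nsets {..<v} t" for T
      using card_nsets_supersets[of "{..<v}" T k] that tk
      by (simp add: Te_def card_cartesian_product R_def nsets_def)
    have TeV: "Te T \<subseteq> V" if "T \<in> nsets {..<v} t" for T
      by (auto simp: Te_def V_def slots_def)
    have fn: "finite (nsets {..<v} m)" for m by (simp add: finite_imp_finite_nsets)
    have cn: "card (nsets {..<v} m) = v choose m" for m by (simp add: card_nsets_eq)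
    have R\<eta>: "1 \<le> \<eta> v * R"
    proof -
      have "\<rho> \<le> R" using Q1 R1 by (simp add: \<rho>_def divide_le_eq)
      then have "\<eta> v * \<rho> \<le> \<eta> v * R" using \<eta>0 by simp
      moreover have "\<eta> v / 2 * \<rho> \<le> \<eta> v * \<rho>" using \<eta>0 \<rho>0 by (intro mult_right_mono) auto
      ultimately show ?thesis using \<rho>\<eta> by linarith
    qed
    have fV: "finite V" unfolding V_def by (rule finite_slots)
    have "\<exists>M\<subseteq>H. (\<forall>e\<in>M. \<forall>f\<in>M. e \<noteq> f \<longrightarrow> e \<inter> f = {}) \<and>
      (\<forall>S\<in>Te ` nsets {..<v} t. real (card (S - \<Union>M)) \<le> \<epsilon> * real (card S))"
    proof (rule npm[of V H D "\<eta> v"])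
      show "finite V" by (rule fV)
      show "\<forall>e\<in>H. e \<subseteq> V \<and> card e = K"
        using star_in_slots unfolding H_def V_def K_def by blast
      show "0 < D" by (rule D0)
      show "\<forall>x\<in>V. \<bar>real (card {e\<in>H. x \<in> e}) - D\<bar> \<le> c * D"
      proof
        fix x assume "x \<in> V"
        then consider S where "x = (S, 0)" "S \<in> nsets {..<v} k"
          | T i where "x = (T, i)" "T \<in> nsets {..<v} t" "i \<in> {1..r}"
          by (auto simp: V_def slots_def)
        then show "\<bar>real (card {e\<in>H. x \<in> e}) - D\<bar> \<le> c * D"
        proof cases
          case 1
          then have "real (card {e\<in>H. x \<in> e}) = E * real r"
            using degree_k[OF 1(2)] by (simp add: H_def E_def)
          moreover have "E * \<rho> \<le> E * real r" "E * real r \<le> E * (\<rho> + 1)"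
            using r E0 by (auto intro!: mult_left_mono)
          moreover have "E \<le> c * D"
          proof -
            have "\<eta> v / 2 * D \<le> c * D" using \<eta>c(1) \<eta>0 D0 by (intro mult_right_mono) auto
            then show ?thesis using EA by linarith
          qed
          ultimately show ?thesis using DE by (simp add: algebra_simps)
        next
          case 2
          then show ?thesis using degree_t[OF 2(2,3)] c D0 by (simp add: H_def D_def)
        qed
      qed
      show "\<forall>x y. x \<noteq> y \<longrightarrow> real (card {e\<in>H. x \<in> e \<and> y \<in> e}) \<le> \<eta> v * D"
      proof (intro allI impI)
        fix x y :: "nat set \<times> nat" assume "x \<noteq> y"
        have "real (card {e\<in>H. x \<in> e \<and> y \<in> e})
          \<le> real (max (((v - Suc k) choose (b - Suc k)) * r) ((v - Suc t) choose (b - Suc t)))"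
          unfolding H_def using codegree[OF \<open>x \<noteq> y\<close>] by (simp only: of_nat_le_iff)
        then have "real (card {e\<in>H. x \<in> e \<and> y \<in> e})
          \<le> max (real ((v - Suc k) choose (b - Suc k)) * real r) (real ((v - Suc t) choose (b - Suc t)))"
          by (simp only: of_nat_max of_nat_mult)
        moreover have "real ((v - Suc k) choose (b - Suc k)) * real r \<le> \<eta> v * D"
        proof -
          have "real ((v - Suc k) choose (b - Suc k)) * real r \<le> (\<eta> v / 2 * E) * (2 * \<rho>)"
            using Ak r \<rho>1 \<eta>0 E0 by (intro mult_mono) auto
          then show ?thesis by (simp add: DE ac_simps)
        qed
        moreover have "\<eta> v / 2 * D \<le> \<eta> v * D" using \<eta>0 D0 by (intro mult_right_mono) auto
        ultimately show "real (card {e\<in>H. x \<in> e \<and> y \<in> e}) \<le> \<eta> v * D" using At by linarith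
      qed
      show "finite (Te ` nsets {..<v} t)" using fn by simp
      show "\<forall>S\<in>Te ` nsets {..<v} t. S \<subseteq> V \<and> 1 \<le> \<eta> v * real (card S)"
        using cTe TeV R\<eta> by auto
      show "1 \<le> \<eta> v * real (card V)"
      proof -
        have "{..<t} \<in> nsets {..<v} t" using tk v by (auto simp: nsets_def)
        then have "R = real (card (Te {..<t}))" "card (Te {..<t}) \<le> card V"
          using cTe TeV by (auto intro!: card_mono[OF fV])
        then have "R \<le> real (card V)" by linarith
        then have "\<eta> v * R \<le> \<eta> v * real (card V)" using \<eta>0 by simp
        then show ?thesis using R\<eta> by linarith
      qed
      show "\<eta> v * ln (2 * real (card V + card (Te ` nsets {..<v} t)) + 1) \<le> c"
      proof -
        define x where "x = real v ^ k"
        have v1: "1 \<le> real v" using v by simp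
        have x1: "1 \<le> x" using v1 by (simp add: x_def)
        have bk: "real (v choose m) \<le> real v ^ m" if "m \<le> k" for m
        proof -
          have "v choose m \<le> v ^ m" using that v tk by (intro binomial_le_pow) auto
          then have "real (v choose m) \<le> real (v ^ m)" by (simp only: of_nat_le_iff)
          then show ?thesis by simp
        qed
        have tx: "real v ^ t \<le> x" unfolding x_def using v1 tk by (intro power_increasing) auto
        have \<rho>x: "\<rho> \<le> real v ^ (k - t)"
        proof -
          have "\<rho> \<le> R" using Q1 R1 by (simp add: \<rho>_def divide_le_eq)
          also have "R \<le> real (v - t) ^ (k - t)"
          proof -
            have "(v - t) choose (k - t) \<le> (v - t) ^ (k - t)" using v tk by (intro binomial_le_pow) auto
            then have "R \<le> real ((v - t) ^ (k - t))" unfolding R_def by (simp only: of_nat_le_iff)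
            then show ?thesis by simp
          qed
          also have "\<dots> \<le> real v ^ (k - t)" by (intro power_mono) auto
          finally show ?thesis .
        qed
        have "card V \<le> card (nsets {..<v} k \<times> {0::nat}) + card (nsets {..<v} t \<times> {1..r})"
          unfolding V_def slots_def by (rule card_Un_le)
        then have "real (card V) \<le> real (v choose k) + real (v choose t) * real r"
          by (simp add: card_cartesian_product cn flip: of_nat_mult of_nat_add)
        also have "\<dots> \<le> x + real v ^ t * (real v ^ (k - t) + 1)"
          using bk[of k] bk[of t] tk r(2) \<rho>x unfolding x_def by (intro add_mono mult_mono) auto
        also have "real v ^ t * (real v ^ (k - t) + 1) = x + real v ^ t"
          using tk by (simp add: x_def algebra_simps flip: power_add)
        finally have "real (card V) \<le> 3 * x" using tx by linarith
        moreover have "real (card (Te ` nsets {..<v} t)) \<le> x"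
        proof -
          have "card (Te ` nsets {..<v} t) \<le> v choose t" using card_image_le[OF fn, of Te t] by (simp add: cn)
          then show ?thesis using bk[of t] tk tx by linarith
        qed
        ultimately have "2 * real (card V + card (Te ` nsets {..<v} t)) + 1 \<le> 9 * x" using x1 by simp
        then have "ln (2 * real (card V + card (Te ` nsets {..<v} t)) + 1) \<le> ln (9 * x)"
          by (subst ln_le_cancel_iff) (use x1 in \<open>auto simp: add_nonneg_pos\<close>)
        also have "\<dots> = ln 9 + real k * ln (real v)"
          using x1 v1 unfolding x_def by (subst ln_mult) (auto simp: ln_realpow)
        finally have "\<eta> v * ln (2 * real (card V + card (Te ` nsets {..<v} t)) + 1) \<le> \<eta> v * (ln 9 + real k * ln (real v))"
          using \<eta>0 by (intro mult_left_mono) auto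
        then show ?thesis using elim(3) by linarith
      qed
    qed
    then obtain M where M: "M \<subseteq> H" and dj: "\<And>e f. e \<in> M \<Longrightarrow> f \<in> M \<Longrightarrow> e \<noteq> f \<Longrightarrow> e \<inter> f = {}"
      and left: "\<And>T. T \<in> nsets {..<v} t \<Longrightarrow> real (card (Te T - \<Union>M)) \<le> \<epsilon> * R"
      by (elim exE conjE) (simp add: cTe)
    \<comment> \<open>The uncovered sets become blocks themselves, with colors beyond \<open>r\<close>.\<close>
    define U where "U = {e\<in>nsets {..<v} k. (e, 0) \<notin> \<Union>M}"
    have fU: "finite U" using fn by (simp add: U_def)
    define Rel where "Rel = (\<lambda>e f :: nat set. e \<noteq> f \<and> t \<le> card (e \<inter> f))"
    define d where "d = nat \<lfloor>P * (\<epsilon> * R)\<rfloor>"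
    have degU: "card {f\<in>U. Rel e f} \<le> d" if e: "e \<in> U" for e
    proof -
      have ek: "e \<subseteq> {..<v}" "card e = k" "finite e" using e by (auto simp: U_def nsets_def)
      have sub: "{f\<in>U. Rel e f} \<subseteq> (\<Union>T\<in>nsets e t. fst ` (Te T - \<Union>M))"
      proof
        fix f assume f: "f \<in> {f\<in>U. Rel e f}"
        then obtain T where T: "T \<subseteq> e \<inter> f" "card T = t" "finite T"
          using obtain_subset_with_card_n[of t "e \<inter> f"] by (auto simp: Rel_def)
        then have f0: "(f, 0) \<in> Te T - \<Union>M" using f by (auto simp: Te_def U_def)
        have "T \<in> nsets e t" using T by (auto simp: nsets_def)
        then show "f \<in> (\<Union>T\<in>nsets e t. fst ` (Te T - \<Union>M))"
          using image_eqI[OF _ f0, of f fst] by (intro UN_I) simp_all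
      qed
      have fTe: "finite (Te T - \<Union>M)" for T using fn by (simp add: Te_def)
      have fe: "finite (nsets e t)" using ek by (simp add: finite_imp_finite_nsets)
      have "card {f\<in>U. Rel e f} \<le> card (\<Union>T\<in>nsets e t. fst ` (Te T - \<Union>M))"
        using fe fTe by (intro card_mono sub) auto
      also have "\<dots> \<le> (\<Sum>T\<in>nsets e t. card (fst ` (Te T - \<Union>M)))" by (rule card_UN_le[OF fe])
      also have "\<dots> \<le> (\<Sum>T\<in>nsets e t. card (Te T - \<Union>M))" by (intro sum_mono card_image_le fTe)
      finally have "real (card {f\<in>U. Rel e f}) \<le> (\<Sum>T\<in>nsets e t. real (card (Te T - \<Union>M)))"
        by (simp flip: of_nat_sum)
      also have "\<dots> \<le> (\<Sum>T\<in>nsets e t. \<epsilon> * R)"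
        using nsets_mono[OF ek(1)] by (intro sum_mono left) auto
      also have "\<dots> = P * (\<epsilon> * R)" using ek by (simp add: P_def card_nsets_eq)
      finally show ?thesis unfolding d_def by linarith
    qed
    have "\<exists>g :: nat set \<Rightarrow> nat. (\<forall>x\<in>U. g x \<le> d) \<and> (\<forall>x\<in>U. \<forall>y\<in>U. x \<noteq> y \<longrightarrow> Rel x y \<longrightarrow> g x \<noteq> g y)"
      by (rule greedy_coloring[OF fU _ degU]) (auto simp: Rel_def Int_commute)
    then obtain g :: "nat set \<Rightarrow> nat" where g1: "\<forall>x\<in>U. g x \<le> d"
      and g2: "\<forall>x\<in>U. \<forall>y\<in>U. x \<noteq> y \<longrightarrow> Rel x y \<longrightarrow> g x \<noteq> g y"
      by (elim exE conjE)
    note g = g1[rule_format] g2[rule_format]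
    have cov: "\<exists>B a. B \<in> nsets {..<v} b \<and> a \<in> {1..r} \<and> star B a \<in> M \<and> e \<subseteq> B"
      if ek: "e \<in> nsets {..<v} k" "e \<notin> U" for e
    proof -
      obtain s where s: "s \<in> M" "(e, 0) \<in> s" using ek by (auto simp: U_def)
      then obtain B a where B: "B \<in> nsets {..<v} b" "a \<in> {1..r}" "s = star B a"
        using M unfolding H_def stars_def by auto
      then have "e \<in> nsets B k" using s in_star_iff[OF B(2), of e 0 B] by simp
      then show ?thesis using B s by (auto simp: nsets_def)
    qed
    then obtain Bl co where Bc: "\<And>e. e \<in> nsets {..<v} k \<Longrightarrow> e \<notin> U \<Longrightarrow>
      Bl e \<in> nsets {..<v} b \<and> co e \<in> {1..r} \<and> star (Bl e) (co e) \<in> M \<and> e \<subseteq> Bl e"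
      by metis
    define \<beta> where "\<beta> = (\<lambda>e. if e \<in> U then e else Bl e)"
    define \<gamma> where "\<gamma> = (\<lambda>e. if e \<in> U then Suc (r + g e) else co e)"
    have tot: "real (Suc (r + d)) \<le> (1 + \<delta>) * \<rho>"
    proof -
      have "real d \<le> P * (\<epsilon> * R)" unfolding d_def using P1 \<epsilon> R1 by (intro of_nat_floor) auto
      also have "\<dots> = (P * \<epsilon> * Q) * \<rho>" using Q1 by (simp add: \<rho>_def)
      also have "\<dots> \<le> \<delta> / 2 * \<rho>" using \<epsilon>PQ \<rho>0 by (intro mult_right_mono) auto
      finally have "real d \<le> \<delta> / 2 * \<rho>" .
      moreover have "2 \<le> \<delta> / 2 * \<rho>"
      proof -
        have "\<eta> v * \<rho> \<le> \<delta> / 4 * \<rho>" using \<eta>c(3) \<rho>0 by (intro mult_right_mono) auto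
        then show ?thesis using \<rho>\<eta> by simp
      qed
      ultimately have "real (Suc (r + d)) \<le> \<rho> + \<delta> / 2 * \<rho> + \<delta> / 2 * \<rho>" using r(2) by simp
      then show ?thesis by (simp add: algebra_simps)
    qed
    show ?case
    proof (intro exI[of _ \<beta>] exI[of _ \<gamma>] conjI ballI impI)
      fix e assume e: "e \<in> nsets {..<v} k"
      have fe: "finite e" "card e = k" using e by (auto simp: nsets_def)
      show "e \<subseteq> \<beta> e" "finite (\<beta> e)" "card (\<beta> e) \<le> b" "1 \<le> \<gamma> e"
        using Bc[OF e] tk fe by (auto simp: \<beta>_def \<gamma>_def nsets_def)
      have "\<gamma> e \<le> Suc (r + d)" using Bc[OF e] g(1)[of e] by (auto simp: \<gamma>_def)
      then have "real (\<gamma> e) \<le> (1 + \<delta>) * \<rho>" using tot by linarith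
      then show "real (\<gamma> e) \<le> (1 + \<delta>) * (real ((v - t) choose (k - t)) / real ((b - t) choose (k - t)))"
        by (simp add: \<rho>_def R_def Q_def)
    next
      fix e f assume e: "e \<in> nsets {..<v} k" and f: "f \<in> nsets {..<v} k"
        and eq: "\<gamma> e = \<gamma> f" and tef: "t \<le> card (e \<inter> f)"
      consider "e \<in> U" "f \<in> U" | "e \<in> U" "f \<notin> U" | "e \<notin> U" "f \<in> U" | "e \<notin> U" "f \<notin> U" by auto
      then show "\<beta> e = \<beta> f"
      proof cases
        case 1
        then have "g e = g f" using eq by (simp add: \<gamma>_def)
        then have "e = f" using g(2)[OF 1] tef by (auto simp: Rel_def)
        then show ?thesis by simp
      next
        case 2
        then show ?thesis using eq Bc[OF f 2(2)] by (simp add: \<gamma>_def)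
      next
        case 3
        then show ?thesis using eq Bc[OF e 3(1)] by (simp add: \<gamma>_def)
      next
        case 4
        note be = Bc[OF e 4(1)] and bf = Bc[OF f 4(2)]
        have co: "co e = co f" using eq 4 by (simp add: \<gamma>_def)
        obtain T where T: "T \<subseteq> e \<inter> f" "card T = t" "finite T"
          using tef obtain_subset_with_card_n[of t "e \<inter> f"] by auto
        have "T \<in> nsets (Bl e) t" "T \<in> nsets (Bl f) t" using T be bf by (auto simp: nsets_def)
        then have "(T, co e) \<in> star (Bl e) (co e) \<inter> star (Bl f) (co f)"
          using be bf co in_star_iff[of "co e"] by auto
        then have "star (Bl e) (co e) = star (Bl f) (co f)" using dj be bf by blast
        then have "(Bl e, co e) = (Bl f, co f)"
          using inj_onD[OF inj_star, of "(Bl e, co e)" "(Bl f, co f)"] be bf by simp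
        then show ?thesis using 4 by (simp add: \<beta>_def)
      qed
    qed
  qed
qed

section \<open>From points to vertices\<close>

text \<open>The vertex \<open>i\<close> is mapped to the point \<open>i mod w\<close>. The points from \<open>w\<close> onwards replace the points
  lost by coincidences.\<close>
definition pad :: "nat \<Rightarrow> nat set \<Rightarrow> nat set" where
  "pad w e = (let P = (\<lambda>i. i mod w) ` e in P \<union> {w..<w + (card e - card P)})"

lemma card_pad:
  assumes "finite e" "0 < w"
  shows "card (pad w e) = card e"
proof -
  define P where "P = (\<lambda>i. i mod w) ` e"
  have "P \<subseteq> {..<w}" using assms(2) by (auto simp: P_def)
  moreover have "finite P" "card P \<le> card e" using assms(1) by (auto simp: P_def card_image_le)
  moreover have "P \<inter> {w..<w + (card e - card P)} = {}" using calculation(1) by auto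
  ultimately show ?thesis
    unfolding pad_def P_def[symmetric] Let_def by (subst card_Un_disjoint) auto
qed

lemma pad_subset: "0 < w \<Longrightarrow> pad w e \<subseteq> {..<w + card e}"
  by (auto simp: pad_def Let_def intro: less_le_trans[of _ w])

text \<open>Adding a vertex either adds a point to the image or increases the number of coincidences
  by one, so neither the image nor the number of padding points ever decreases.\<close>
lemma pad_mono:
  assumes "T \<subseteq> e" "finite e"
  shows "pad w T \<subseteq> pad w e"
proof -
  define p where "p = (\<lambda>A. (\<lambda>i. i mod w) ` A)"
  have fT: "finite T" using assms finite_subset by blast
  have "p e = p T \<union> p (e - T)" using assms(1) by (auto simp: p_def)
  then have "card (p e) \<le> card (p T) + card (p (e - T))" using card_Un_le by metis
  also have "card (p (e - T)) \<le> card (e - T)" using assms(2) by (auto simp: p_def intro: card_image_le)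
  also have "card (e - T) = card e - card T" using assms fT by (simp add: card_Diff_subset)
  finally have "card (p e) \<le> card (p T) + (card e - card T)" by simp
  moreover have "card T \<le> card e" using assms by (simp add: card_mono)
  moreover have "p T \<subseteq> p e" using assms(1) by (auto simp: p_def)
  ultimately show ?thesis unfolding pad_def Let_def p_def[symmetric] by fastforce
qed

lemma card_residues_le:
  assumes "0 < w" "finite B"
  shows "card {x. x < n \<and> x mod w \<in> B} \<le> card B * (n div w + 1)"
proof -
  have one: "card {x. x < n \<and> x mod w = a} \<le> n div w + 1" for a
  proof -
    have "inj_on (\<lambda>x. x div w) {x. x < n \<and> x mod w = a}"
      by (rule inj_onI) (metis (mono_tags, lifting) div_mult_mod_eq mem_Collect_eq)
    moreover have "(\<lambda>x. x div w) ` {x. x < n \<and> x mod w = a} \<subseteq> {..n div w}"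
      by (auto intro: div_le_mono)
    ultimately have "card {x. x < n \<and> x mod w = a} \<le> card {..n div w}"
      by (intro card_inj_on_le) auto
    then show ?thesis by simp
  qed
  have "{x. x < n \<and> x mod w \<in> B} = (\<Union>a\<in>B. {x. x < n \<and> x mod w = a})" by auto
  then have "card {x. x < n \<and> x mod w \<in> B} \<le> (\<Sum>a\<in>B. card {x. x < n \<and> x mod w = a})"
    using card_UN_le[OF assms(2)] by metis
  also have "\<dots> \<le> (\<Sum>a\<in>B. n div w + 1)" by (rule sum_mono) (rule one)
  finally show ?thesis by simp
qed

text \<open>An edge gets the color of its padded image. Along a tight component the block \<open>\<beta>\<close> of the padded
  image is constant, so all edges of the component consist of vertices that are mapped into one
  block.\<close>
lemma M_le:
  fixes \<beta> :: "nat set \<Rightarrow> nat set" and \<gamma> :: "nat set \<Rightarrow> nat"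
  assumes w: "0 < w" and kn: "k \<le> n"
    and bl: "\<And>e. e \<in> nsets {..<w + k} k \<Longrightarrow> e \<subseteq> \<beta> e \<and> finite (\<beta> e) \<and> card (\<beta> e) \<le> b \<and> 1 \<le> \<gamma> e \<and> \<gamma> e \<le> r"
    and sep: "\<And>e f. e \<in> nsets {..<w + k} k \<Longrightarrow> f \<in> nsets {..<w + k} k \<Longrightarrow> \<gamma> e = \<gamma> f \<Longrightarrow> t \<le> card (e \<inter> f) \<Longrightarrow> \<beta> e = \<beta> f"
  shows "M n r k t s \<le> min n (b * (n div w + 1)) choose s"
proof -
  define E where "E = nsets {..<n} k"
  have fE: "finite E" by (simp add: E_def finite_imp_finite_nsets)
  have padE: "pad w e \<in> nsets {..<w + k} k" if "e \<in> E" for e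
  proof -
    have e: "finite e" "card e = k" using that by (auto simp: E_def nsets_def)
    have "pad w e \<subseteq> {..<w + k}" using pad_subset[OF w, of e] e by simp
    then show ?thesis using card_pad[OF e(1) w] e by (auto simp: nsets_def dest: finite_subset)
  qed
  define c where "c = restrict (\<lambda>e. \<gamma> (pad w e)) E"
  have c: "c \<in> colorings r E" using bl[OF padE] by (auto simp: c_def colorings_def)
  have comp: "card (shadow s C) \<le> min n (b * (n div w + 1)) choose s"
    if C: "C \<in> tight_components t (color_class E c i)" for C i
  proof -
    define H where "H = color_class E c i"
    have H: "H \<subseteq> E" "\<And>e. e \<in> H \<Longrightarrow> \<gamma> (pad w e) = i" by (auto simp: H_def color_class_def c_def)
    have fH: "finite H" using H(1) fE finite_subset by blast
    obtain e0 where e0: "e0 \<in> H" "C = (tight_adj t H)\<^sup>* `` {e0}"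
      using C unfolding H_def[symmetric] tight_components_eq_quotient[OF fH] by (auto simp: quotient_def)
    have same: "e \<in> H \<and> \<beta> (pad w e) = \<beta> (pad w e0)" if "(e0, e) \<in> (tight_adj t H)\<^sup>*" for e
      using that
    proof (induction rule: rtrancl_induct)
      case base
      then show ?case using e0 by simp
    next
      case (step e f)
      have ef: "e \<in> H" "f \<in> H" "t \<le> card (e \<inter> f)" using step.hyps by (auto simp: tight_adj_def)
      have fin: "finite e" "finite f" using ef H(1) by (auto simp: E_def nsets_def)
      have "card (e \<inter> f) = card (pad w (e \<inter> f))" using card_pad[OF _ w, of "e \<inter> f"] fin by simp
      also have "\<dots> \<le> card (pad w e \<inter> pad w f)"
        using pad_mono[of "e \<inter> f" e w] pad_mono[of "e \<inter> f" f w] fin padE[of e] ef H(1)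
        by (intro card_mono) (auto simp: nsets_def)
      finally have "t \<le> card (pad w e \<inter> pad w f)" using ef by simp
      then have "\<beta> (pad w e) = \<beta> (pad w f)"
        using sep[OF padE padE, of e f] H ef by blast
      then show ?case using step.IH ef by simp
    qed
    define B where "B = \<beta> (pad w e0)"
    have B: "finite B" "card B \<le> b" using bl[OF padE, of e0] e0 H(1) by (auto simp: B_def)
    define W where "W = {x. x < n \<and> x mod w \<in> B}"
    have "e \<subseteq> W" if "e \<in> C" for e
    proof -
      have e: "e \<in> H" "\<beta> (pad w e) = B" using same[of e] that unfolding e0(2) B_def by auto
      then have "e \<in> E" using H by blast
      then have "pad w e \<subseteq> B" "e \<subseteq> {..<n}" using bl[OF padE] e(2) by (auto simp: E_def nsets_def)
      then show ?thesis by (auto simp: W_def pad_def Let_def)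
    qed
    moreover have fW: "finite W" by (simp add: W_def)
    ultimately have "shadow s C \<subseteq> nsets W s" by (fastforce simp: shadow_def nsets_def dest: finite_subset)
    then have "card (shadow s C) \<le> card (nsets W s)" using fW by (intro card_mono finite_imp_finite_nsets)
    also have "\<dots> = card W choose s" using fW by (rule card_nsets_eq)
    also have "\<dots> \<le> min n (b * (n div w + 1)) choose s"
    proof (rule binomial_right_mono)
      have "card W \<le> card {..<n}" by (rule card_mono) (auto simp: W_def)
      moreover have "card W \<le> b * (n div w + 1)"
        using card_residues_le[OF w B(1), of n] mult_right_mono[OF B(2), of "n div w + 1"]
        by (simp add: W_def)
      ultimately show "card W \<le> min n (b * (n div w + 1))" by simp
    qed
    finally show ?thesis .
  qed
  have inner: "(MAX C\<in>tight_components t (color_class E c i). card (shadow s C)) \<le> min n (b * (n div w + 1)) choose s"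
    if ne: "color_class E c i \<noteq> {}" for i
  proof -
    have fH: "finite (color_class E c i)" using fE by (simp add: color_class_def)
    have q: "tight_components t (color_class E c i)
      = (\<lambda>e. (tight_adj t (color_class E c i))\<^sup>* `` {e}) ` color_class E c i"
      unfolding tight_components_eq_quotient[OF fH] by (auto simp: quotient_def)
    have "finite (tight_components t (color_class E c i))" "tight_components t (color_class E c i) \<noteq> {}"
      unfolding q using fH ne by auto
    then show ?thesis using comp by (subst Max_le_iff) auto
  qed
  have "\<exists>e. e \<in> E"
  proof -
    have "{..<k} \<in> E" using kn by (auto simp: E_def nsets_def)
    then show ?thesis ..
  qed
  then obtain e1 where e1: "e1 \<in> E" ..
  then have "c e1 \<in> {i\<in>{1..r}. color_class E c i \<noteq> {}}"
    using c by (auto simp: colorings_def color_class_def)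
  then have "M_coloring n r k t s c \<le> min n (b * (n div w + 1)) choose s"
    unfolding M_coloring_def E_def[symmetric] by (subst Max_le_iff) (use inner in auto)
  moreover have "finite (colorings r E)" using fE by (simp add: colorings_def finite_PiE)
  then have "M n r k t s \<le> M_coloring n r k t s c"
    unfolding M_def E_def[symmetric] using c by (intro Min_le) auto
  ultimately show ?thesis by simp
qed

section \<open>Asymptotics\<close>

lemma binomial_le_ratio_power:
  assumes "x \<le> n" "0 < n"
  shows "real (x choose s) \<le> (real x / real n) ^ s * real (n choose s)"
proof (cases "s \<le> x")
  case False
  then show ?thesis by (simp add: binomial_eq_0)
next
  case True
  have "real (x choose s) = (\<Prod>i=0..<s. real (x - i) / real (s - i))"
    using True by (simp add: binomial_altdef_of_nat)
  also have "\<dots> \<le> (\<Prod>i=0..<s. real x / real n * (real (n - i) / real (s - i)))"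
  proof (rule prod_mono)
    fix i assume i: "i \<in> {0..<s}"
    have "real x * real i \<le> real n * real i" using assms by (intro mult_right_mono) auto
    then have "real (x - i) \<le> real x / real n * real (n - i)"
      using i True assms by (simp add: field_simps of_nat_diff)
    then have "real (x - i) / real (s - i) \<le> real x / real n * real (n - i) / real (s - i)"
      by (rule divide_right_mono) simp
    then show "0 \<le> real (x - i) / real (s - i) \<and>
      real (x - i) / real (s - i) \<le> real x / real n * (real (n - i) / real (s - i))" by simp
  qed
  also have "\<dots> = (real x / real n) ^ s * (\<Prod>i=0..<s. real (n - i) / real (s - i))"
    by (simp only: prod.distrib prod_constant card_atLeastLessThan diff_zero)
  also have "(\<Prod>i=0..<s. real (n - i) / real (s - i)) = real (n choose s)"
    using True assms by (intro binomial_altdef_of_nat[symmetric]) simp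
  finally show ?thesis .
qed

lemma binomial_ratio_le_power:
  assumes "t < k" "k < b" "b \<le> v"
  shows "real ((v - t) choose (k - t)) / real ((b - t) choose (k - t)) \<le> (real v / real (b - k)) ^ (k - t)"
proof -
  define d where "d = k - t"
  have alt: "real ((v - t) choose d) = (\<Prod>i=0..<d. real (v - t - i) / real (d - i))"
    "real ((b - t) choose d) = (\<Prod>i=0..<d. real (b - t - i) / real (d - i))"
    unfolding d_def by (rule binomial_altdef_of_nat, use assms in simp)+
  have "real ((v - t) choose d) / real ((b - t) choose d)
      = (\<Prod>i=0..<d. (real (v - t - i) / real (d - i)) / (real (b - t - i) / real (d - i)))"
    unfolding alt by (rule prod_dividef[symmetric])
  also have "\<dots> \<le> (\<Prod>i=0..<d. real v / real (b - k))"
  proof (rule prod_mono)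
    fix i assume i: "i \<in> {0..<d}"
    have "(real (v - t - i) / real (d - i)) / (real (b - t - i) / real (d - i)) = real (v - t - i) / real (b - t - i)"
      using i by simp
    also have "\<dots> \<le> real v / real (b - k)"
      using i assms by (intro frac_le) (auto simp: d_def)
    finally show "0 \<le> (real (v - t - i) / real (d - i)) / (real (b - t - i) / real (d - i)) \<and>
      (real (v - t - i) / real (d - i)) / (real (b - t - i) / real (d - i)) \<le> real v / real (b - k)" by simp
  qed
  finally show ?thesis by (simp add: d_def)
qed

theorem theorem1p2:
  fixes \<epsilon> :: real and k t s :: nat
  assumes "\<epsilon> > 0"
    and "k > 0" and "t > 0" and "s > 0"
    and "max (t + 1) s \<le> k"
  shows "\<exists>r\<^sub>0>0. \<forall>r\<ge>r\<^sub>0. \<exists>N. \<forall>n\<ge>N.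
    real (M n r k t s) \<le> (1 + \<epsilon>) * real r powr (- (real s / (real k - real t))) * real (n choose s)"
proof -
  define d where "d = k - t"
  have tk: "1 \<le> t" "t < k" and d1: "1 \<le> d" using assms by (auto simp: d_def)
  define \<eta> where "\<eta> = (1 + \<epsilon>) powr (1 / real s) - 1"
  have \<eta>0: "0 < \<eta>" using assms(1,4) by (simp add: \<eta>_def)
  have \<eta>s: "(1 + \<eta>) ^ s = 1 + \<epsilon>"
    using assms(1,4) by (simp add: \<eta>_def powr_powr flip: powr_realpow)
  define \<delta> where "\<delta> = \<eta> / 3"
  have \<delta>0: "0 < \<delta>" using \<eta>0 by (simp add: \<delta>_def)
  \<comment> \<open>The block size \<open>b = k + m\<close> is large enough that \<open>b / (b - k)\<close> is smaller than
    \<open>(1 + \<eta>) / (1 + \<delta>)\<close>; this gap also pays for the padding points and for rounding.\<close>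
  obtain m :: nat where m: "real k * (1 + \<delta>) < real m * (\<eta> - \<delta>)"
    using reals_Archimedean3[of "\<eta> - \<delta>"] \<eta>0 by (auto simp: \<delta>_def)
  have m1: "1 \<le> m"
  proof (rule ccontr)
    assume "\<not> 1 \<le> m"
    then have "m = 0" by simp
    then have "real k * (1 + \<delta>) < 0" using m by simp
    then show False using \<delta>0 by (simp add: mult_less_0_iff)
  qed
  define b where "b = k + m"
  have kb: "k < b" using m1 by (simp add: b_def)
  define \<kappa> where "\<kappa> = real m / (1 + \<delta>)"
  have \<kappa>0: "0 < \<kappa>" using m1 \<delta>0 by (simp add: \<kappa>_def)
  have gap: "0 < (1 + \<eta>) * \<kappa> - real b"
  proof -
    have "real b * (1 + \<delta>) < (1 + \<eta>) * real m" using m by (simp add: b_def algebra_simps)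
    then show ?thesis using \<delta>0 by (simp add: \<kappa>_def field_simps)
  qed
  define y where "y = (\<lambda>r::nat. real r powr (1 / real d))"
  \<comment> \<open>At most \<open>\<kappa> y r\<close> points ensure that the \<open>(1 + \<delta>) (v / (b - k))^d\<close> colors are at most \<open>r\<close>.\<close>
  define v where "v = (\<lambda>r. nat \<lfloor>\<kappa> * y r\<rfloor>)"
  have y_lim: "filterlim y at_top sequentially"
    unfolding y_def using d1 by real_asymp
  have v_lim: "filterlim v at_top sequentially"
  proof -
    have "filterlim (\<lambda>r. \<kappa> * y r) at_top sequentially"
      by (rule filterlim_tendsto_pos_mult_at_top[OF tendsto_const \<kappa>0 y_lim])
    then have "filterlim (\<lambda>r. \<lfloor>\<kappa> * y r\<rfloor>) at_top sequentially"
      by (rule filterlim_compose[OF filterlim_floor_sequentially])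
    then show ?thesis unfolding v_def by (rule filterlim_compose[OF filterlim_nat_sequentially])
  qed
  note design = eventually_compose_filterlim[OF tight_block_coloring[OF tk kb \<delta>0] v_lim]
  have ev_v: "\<forall>\<^sub>F r in sequentially. b < v r"
    using eventually_compose_filterlim[OF eventually_gt_at_top v_lim] .
  have ev_y: "\<forall>\<^sub>F r in sequentially. (1 + \<eta>) * (1 + real k) / ((1 + \<eta>) * \<kappa> - real b) < y r"
    using eventually_compose_filterlim[OF eventually_gt_at_top y_lim] .
  have "\<forall>\<^sub>F r in sequentially. \<exists>N. \<forall>n\<ge>N.
    real (M n r k t s) \<le> (1 + \<epsilon>) * real r powr (- (real s / (real k - real t))) * real (n choose s)"
    using design ev_v ev_y eventually_gt_at_top[of 0]
  proof eventually_elim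
    case (elim r)
    have r0: "0 < real r" using elim by simp
    have y0: "0 < y r" using r0 by (simp add: y_def)
    have yd: "y r ^ d = real r" using r0 d1 by (simp add: y_def powr_powr flip: powr_realpow)
    define w where "w = v r - k"
    have vw: "v r = w + k" "0 < w" using elim(2) kb by (auto simp: w_def)
    from elim(1) obtain \<beta> :: "nat set \<Rightarrow> nat set" and \<gamma> :: "nat set \<Rightarrow> nat" where
      bl: "\<forall>e\<in>nsets {..<v r} k. e \<subseteq> \<beta> e \<and> finite (\<beta> e) \<and> card (\<beta> e) \<le> b \<and> 1 \<le> \<gamma> e \<and>
        real (\<gamma> e) \<le> (1 + \<delta>) * (real ((v r - t) choose (k - t)) / real ((b - t) choose (k - t)))"
      and sep: "\<forall>e\<in>nsets {..<v r} k. \<forall>f\<in>nsets {..<v r} k.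
        \<gamma> e = \<gamma> f \<longrightarrow> t \<le> card (e \<inter> f) \<longrightarrow> \<beta> e = \<beta> f"
      by (elim exE conjE)
    note bl = bspec[OF bl] and sep = sep[rule_format]
    have v_le: "real (v r) \<le> \<kappa> * y r" unfolding v_def using \<kappa>0 y0 by (intro of_nat_floor) auto
    have v_ge: "\<kappa> * y r - 1 < real (v r)" unfolding v_def by linarith
    have cols: "(1 + \<delta>) * (real ((v r - t) choose (k - t)) / real ((b - t) choose (k - t))) \<le> real r"
    proof -
      have "real (v r) / real (b - k) \<le> \<kappa> * y r / real (b - k)" using v_le by (rule divide_right_mono) simp
      also have "\<dots> = y r / (1 + \<delta>)" using m1 by (simp add: \<kappa>_def b_def)
      finally have "(real (v r) / real (b - k)) ^ d \<le> (y r / (1 + \<delta>)) ^ d" by (intro power_mono) auto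
      then have "real ((v r - t) choose (k - t)) / real ((b - t) choose (k - t)) \<le> real r / (1 + \<delta>) ^ d"
        using binomial_ratio_le_power[OF tk(2) kb, of "v r"] elim(2) by (simp add: d_def[symmetric] power_divide yd)
      then have "(1 + \<delta>) * (real ((v r - t) choose (k - t)) / real ((b - t) choose (k - t)))
          \<le> (1 + \<delta>) * (real r / (1 + \<delta>) ^ d)" using \<delta>0 by (intro mult_left_mono) auto
      also have "\<dots> \<le> (1 + \<delta>) * (real r / (1 + \<delta>))"
        using \<delta>0 self_le_power[of "1 + \<delta>" d] d1 by (intro mult_left_mono divide_left_mono) auto
      finally show ?thesis using \<delta>0 by simp
    qed
    define a where "a = (1 + \<eta>) / y r"
    have aw: "real b / real w < a"
    proof -
      have "(1 + \<eta>) * (1 + real k) < y r * ((1 + \<eta>) * \<kappa> - real b)"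
        using elim(3) gap by (simp add: divide_less_eq)
      then have "real b * y r < (1 + \<eta>) * (\<kappa> * y r - 1 - real k)" by (simp add: algebra_simps)
      also have "\<dots> \<le> (1 + \<eta>) * real w"
        using v_ge vw \<eta>0 by (intro mult_left_mono) auto
      finally show ?thesis using y0 vw(2) by (simp add: a_def field_simps)
    qed
    obtain N0 :: nat where N0: "real b / (a - real b / real w) \<le> real N0" using real_arch_simple by blast
    show ?case
    proof (intro exI[of _ "max k N0"] allI impI)
      fix n assume n: "max k N0 \<le> n"
      have n0: "0 < n" using n assms(2) by simp
      define x where "x = min n (b * (n div w + 1))"
      have "M n r k t s \<le> x choose s"
        unfolding x_def
      proof (rule M_le[OF vw(2)])
        show "k \<le> n" using n by simp
        show "e \<subseteq> \<beta> e \<and> finite (\<beta> e) \<and> card (\<beta> e) \<le> b \<and> 1 \<le> \<gamma> e \<and> \<gamma> e \<le> r"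
          if "e \<in> nsets {..<w + k} k" for e
        proof -
          have "real (\<gamma> e) \<le> real r" using bl[of e] that cols vw(1) by (auto intro: order_trans)
          then show ?thesis using bl[of e] that vw(1) by simp
        qed
        show "\<beta> e = \<beta> f" if "e \<in> nsets {..<w + k} k" "f \<in> nsets {..<w + k} k" "\<gamma> e = \<gamma> f" "t \<le> card (e \<inter> f)" for e f
          using sep[of e f] that vw(1) by simp
      qed
      then have "real (M n r k t s) \<le> real (x choose s)" by simp
      also have "\<dots> \<le> (real x / real n) ^ s * real (n choose s)"
        by (rule binomial_le_ratio_power) (use n0 in \<open>auto simp: x_def\<close>)
      also have "\<dots> \<le> a ^ s * real (n choose s)"
      proof (intro mult_right_mono power_mono)
        have "real x \<le> real (b * (n div w + 1))" by (simp only: x_def of_nat_le_iff min.cobounded2)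
        also have "\<dots> = real b * real (n div w) + real b" by (simp add: algebra_simps)
        also have "\<dots> \<le> real b * (real n / real w) + real b"
          by (intro add_right_mono mult_left_mono of_nat_div_le_of_nat) auto
        also have "\<dots> \<le> a * real n"
        proof -
          have "real b / (a - real b / real w) \<le> real n" using N0 n by linarith
          then have "real b \<le> real n * (a - real b / real w)" using aw by (simp add: divide_le_eq)
          then show ?thesis by (simp add: algebra_simps)
        qed
        finally show "real x / real n \<le> a" using n0 by (simp add: divide_le_eq)
      qed auto
      also have "a ^ s = (1 + \<epsilon>) * real r powr (- (real s / (real k - real t)))"
      proof -
        have "y r ^ s = real r powr (real s / real d)"
          using r0 by (simp add: y_def powr_powr flip: powr_realpow)
        moreover have "real d = real k - real t" using tk by (simp add: d_def)
        moreover have "a ^ s = (1 + \<epsilon>) / y r ^ s" by (simp add: a_def power_divide \<eta>s)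
        ultimately have "a ^ s = (1 + \<epsilon>) / real r powr (real s / (real k - real t))" by simp
        then show ?thesis by (simp add: powr_minus_divide)
      qed
      finally show "real (M n r k t s) \<le> (1 + \<epsilon>) * real r powr (- (real s / (real k - real t))) * real (n choose s)" .
    qed
  qed
  then obtain r0 where "\<forall>r\<ge>r0. \<exists>N. \<forall>n\<ge>N.
    real (M n r k t s) \<le> (1 + \<epsilon>) * real r powr (- (real s / (real k - real t))) * real (n choose s)"
    by (auto simp: eventually_sequentially)
  then show ?thesis by (intro exI[of _ "max 1 r0"]) auto
qed

end
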